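(* Fix $(s_0,b_0,b_1,s_1)\in\Theta$ and $\kappa\in\mathcal K$. Let $\Upsilon:L^1\to L^1$ be the resulting RealLife Euclidean automaton, and for $\epsilon>0$ let $\Upsilon_\epsilon:L^1\to L^1$ be its discrete approximation. (a) If $\mathbf a\in{}^0\!\mathcal A^{\mathbb R^D}$, then $\lim_{\epsilon\to0}\|\Upsilon_\epsilon(\mathbf a)-\Upsilon(\mathbf a)\|_1=0$. (b) If $\epsilon_n>0$ and $\lim_{n\to\infty}\epsilon_n=0$, then $\{\Upsilon_{\epsilon_n}\}_{n=1}^\infty$ evolves to $\Upsilon$ on ${}^0\!\mathcal A^{\mathbb R^D}$.
   Context: Let $D\ge 1$, let $\lambda$ be Lebesgue measure on $\mathbb R^D$, $L^1=L^1(\mathbb R^D,\lambda)$. $\mathcal A^{\mathbb R^D}$ is the set of Borel-measurable functions $\mathbf a:\mathbb R^D\to\{0,1\}$; ${}^1\!\mathcal A^{\mathbb R^D}=\mathcal A^{\mathbb R^D}\cap L^1$. $\mathcal K$ is the set of $\kappa\in L^\infty(\mathbb R^D;[0,\infty))$ with compact support and $\int\kappa\,d\lambda=1$; $(\kappa*\mathbf a)(x)=\int\kappa(y)\mathbf a(x-y)\,d\lambda(y)$. $\Theta=\{(s_0,b_0,b_1,s_1): 0<s_0\le b_0<b_1\le s_1\le 1\}$. Put $\mathfrak s=\mathbf 1_{[s_0,s_1]}$, $\mathfrak b=\mathbf 1_{[b_0,b_1]}$. RealLife: $\Upsilon(\mathbf a)=\mathbf a\cdot\mathfrak s\circ(\kappa*\mathbf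 a)+(1-\mathbf a)\cdot\mathfrak b\circ(\kappa*\mathbf a)$ for $\mathbf a\in L^1$. ${}^0\!\mathcal A^{\mathbb R^D}=\{\mathbf a\in{}^1\!\mathcal A^{\mathbb R^D}: \lambda\{x:\kappa*\mathbf a(x)\in\{s_0,b_0,b_1,s_1\}\}=0\}$. Discrete approximation: for $\epsilon>0$ and $\mathsf z\in\mathbb Z^D$ let $\mathbf C(\mathsf z,\epsilon)=\epsilon\mathsf z+[-\frac\epsilon2,\frac\epsilon2)^D$; let $\mathcal B_\epsilon$ be the sigma-algebra generated by these cubes. Let $\mathbb E_\epsilon:L^1\to L^1$ be conditional expectation onto $\mathcal B_\epsilon$: $\mathbb E_\epsilon[\mathbf a](x)=\epsilon^{-D}\int_{\mathbf C}\mathbf a\,d\lambda$, where $\mathbf C$ is the cube $\mathbf C(\mathsf z,\epsilon)$ containing $x$. Let $k_{\mathsf z}=\int_{\mathbf C(\mathsf z,\epsilon)}\kappa\,d\lambda$ and let $\bar\kappa_\epsilon=\sum_{\mathsf z\in\mathbb Z^D}k_{\mathsf z}\delta_{\epsilon\mathsf z}$ (a probability measure on $\epsilon\mathbb Z^D$), so $(\bar\kappa_\epsilon*\mathbf b)(x)=\sum_{\mathsf z}k_{\mathsf z}\mathbf b(x-\epsilon\mathsf z)$. For $\mathbf a\in L^1$, with $\mathbf b=\mathbb E_\epsilon[\mathbf a]$, $$\Upsilon_\epsilon(\mathbf a)=\mathbf b\cdot\mathfrak s\circ(\bar\kappa_\epsilon*\mathbf b)+(1-\mathbf b)\cdot\mathfrak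 b\circ(\bar\kappa_\epsilon*\mathbf b).$$ Shifts: $\sigma^v(\mathbf a)(x)=\mathbf a(x+v)$, $v\in\mathbb R^D$. Evolution: let $\Phi,\Phi_n:L^1\to L^1$ ($n\in\mathbb N$) be maps and $\mathfrak A\subset L^1$ a shift-invariant subset. $\{\Phi_n\}$ evolves to $\Phi$ on $\mathfrak A$ if, for every sequence $\{\mathbf a_n\}\subset L^1$ converging in $L^1$ to some $\mathbf a\in\mathfrak A$: (1) if $\Phi_n(\mathbf a_n)=\mathbf a_n$ for all $n$, then $\Phi(\mathbf a)=\mathbf a$; (2) for every $P\in\mathbb N$ such that $\Phi^p(\mathbf a)\in\mathfrak A$ for all $0\le p<P$: [i] if $\Phi_n^P(\mathbf a_n)=\mathbf a_n$ for all $n$, then $\Phi^P(\mathbf a)=\mathbf a$; [ii] if $v_n\to v$ in $\mathbb R^D$ and $\Phi_n^P(\mathbf a_n)=\sigma^{Pv_n}(\mathbf a_n)$ for all $n$, then $\Phi^P(\mathbf a)=\sigma^{Pv}(\mathbf a)$. *)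

theory Defs
  imports "HOL-Analysis.Analysis"
begin

text \<open>
  Elements of \<open>L\<^sup>1(\<real>\<^sup>D)\<close> are represented by integrable Borel functions on \<open>real ^ 'n\<close>, and equality in
  \<open>L\<^sup>1\<close> is equality almost everywhere. Accordingly, subsets of \<open>L\<^sup>1\<close> are sets of integrable functions
  closed under a.e. equality, and maps on \<open>L\<^sup>1\<close> are maps on functions that preserve integrability and
  a.e. equality.
\<close>

definition L1 :: "(real ^ 'n \<Rightarrow> real) set" where
  "L1 = {f. integrable lborel f}"

definition L1_eq :: "(real ^ 'n \<Rightarrow> real) \<Rightarrow> (real ^ 'n \<Rightarrow> real) \<Rightarrow> bool" (infix "\<doteq>" 50) where
  "f \<doteq> g \<longleftrightarrow> (AE x in lborel. f x = g x)"

text \<open>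
  The norm is a nonnegative extended integral, since the Bochner integral of a non-integrable
  function would be \<open>0\<close>.
\<close>
definition L1_norm :: "(real ^ 'n \<Rightarrow> real) \<Rightarrow> ennreal" where
  "L1_norm f = (\<integral>\<^sup>+x. ennreal \<bar>f x\<bar> \<partial>lborel)"

definition L1_subset :: "(real ^ 'n \<Rightarrow> real) set \<Rightarrow> bool" where
  "L1_subset A \<longleftrightarrow> A \<subseteq> L1 \<and> (\<forall>f\<in>A. \<forall>g\<in>L1. f \<doteq> g \<longrightarrow> g \<in> A)"

definition L1_map :: "((real ^ 'n \<Rightarrow> real) \<Rightarrow> (real ^ 'n \<Rightarrow> real)) \<Rightarrow> bool" where
  "L1_map \<Phi> \<longleftrightarrow>
     (\<forall>f\<in>L1. \<Phi> f \<in> L1) \<and> (\<forall>f\<in>L1. \<forall>g\<in>L1. f \<doteq> g \<longrightarrow> \<Phi> f \<doteq> \<Phi> g)"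

text \<open>The subset of \<open>L\<^sup>1\<close> consisting of the classes of the functions in \<open>A\<close>.\<close>
definition L1_classes :: "(real ^ 'n \<Rightarrow> real) set \<Rightarrow> (real ^ 'n \<Rightarrow> real) set" where
  "L1_classes A = {f \<in> L1. \<exists>a\<in>A. f \<doteq> a}"

definition shift :: "real ^ 'n \<Rightarrow> (real ^ 'n \<Rightarrow> real) \<Rightarrow> real ^ 'n \<Rightarrow> real" where
  "shift v a = (\<lambda>x. a (x + v))"

definition shift_invariant :: "(real ^ 'n \<Rightarrow> real) set \<Rightarrow> bool" where
  "shift_invariant A \<longleftrightarrow> (\<forall>v. \<forall>a\<in>A. shift v a \<in> A)"


definition configs :: "(real ^ 'n \<Rightarrow> real) set" where
  "configs = {a. a \<in> borel_measurable borel \<and> (\<forall>x. a x \<in> {0, 1})}"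

definition configs1 :: "(real ^ 'n \<Rightarrow> real) set" where
  "configs1 = configs \<inter> L1"

text \<open>
  The conditions on a kernel are conditions on its class in \<open>L\<^sup>\<infinity>\<close>: all constructions below depend on
  \<open>\<kappa>\<close> only through that class, and compact support is vanishing a.e. outside a compact set.
\<close>
definition kernels :: "(real ^ 'n \<Rightarrow> real) set" where
  "kernels = {\<kappa>. \<kappa> \<in> borel_measurable borel \<and>
     (AE x in lborel. 0 \<le> \<kappa> x) \<and>
     (\<exists>B. AE x in lborel. \<kappa> x \<le> B) \<and>
     (\<exists>K. compact K \<and> (AE x in lborel. x \<notin> K \<longrightarrow> \<kappa> x = 0)) \<and>
     (\<integral>x. \<kappa> x \<partial>lborel) = 1}"

definition conv :: "(real ^ 'n \<Rightarrow> real) \<Rightarrow> (real ^ 'n \<Rightarrow> real) \<Rightarrow> real ^ 'n \<Rightarrow> real" where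
  "conv \<kappa> a x = (\<integral>y. \<kappa> y * a (x - y) \<partial>lborel)"

definition Theta :: "(real \<times> real \<times> real \<times> real) set" where
  "Theta = {(s0, b0, b1, s1). 0 < s0 \<and> s0 \<le> b0 \<and> b0 < b1 \<and> b1 \<le> s1 \<and> s1 \<le> 1}"

text \<open>
  The birth/survival rule shared by the Euclidean automaton and its discrete approximation:
  \<open>a\<close> is the current state and \<open>u\<close> the neighbourhood average.
\<close>
fun life_rule :: "real \<times> real \<times> real \<times> real \<Rightarrow>
    (real ^ 'n \<Rightarrow> real) \<Rightarrow> (real ^ 'n \<Rightarrow> real) \<Rightarrow> real ^ 'n \<Rightarrow> real" where
  "life_rule (s0, b0, b1, s1) a u x =
     a x * indicator {s0..s1} (u x) + (1 - a x) * indicator {b0..b1} (u x)"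

definition RealLife :: "real \<times> real \<times> real \<times> real \<Rightarrow> (real ^ 'n \<Rightarrow> real) \<Rightarrow>
    (real ^ 'n \<Rightarrow> real) \<Rightarrow> real ^ 'n \<Rightarrow> real" where
  "RealLife \<theta> \<kappa> a = life_rule \<theta> a (conv \<kappa> a)"

fun configs0 :: "real \<times> real \<times> real \<times> real \<Rightarrow> (real ^ 'n \<Rightarrow> real) \<Rightarrow>
    (real ^ 'n \<Rightarrow> real) set" where
  "configs0 (s0, b0, b1, s1) \<kappa> =
     {a \<in> configs1. {x. conv \<kappa> a x \<in> {s0, b0, b1, s1}} \<in> null_sets lborel}"


definition lattice_point :: "int ^ 'n \<Rightarrow> real ^ 'n" where
  "lattice_point z = (\<chi> i. real_of_int (z $ i))"

definition cube :: "real \<Rightarrow> int ^ 'n \<Rightarrow> (real ^ 'n) set" where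
  "cube \<epsilon> z = {x. \<forall>i. \<epsilon> * real_of_int (z $ i) - \<epsilon> / 2 \<le> x $ i \<and>
                      x $ i < \<epsilon> * real_of_int (z $ i) + \<epsilon> / 2}"

lemma cube_iff_floor:
  assumes "\<epsilon> > 0"
  shows "x \<in> cube \<epsilon> z \<longleftrightarrow> z = (\<chi> i. \<lfloor>x $ i / \<epsilon> + 1 / 2\<rfloor>)"
proof -
  have "(r - 1 / 2) * \<epsilon> = \<epsilon> * r - \<epsilon> / 2" "(r + 1 / 2) * \<epsilon> = \<epsilon> * r + \<epsilon> / 2" for r
    by (simp_all add: algebra_simps)
  then have scale: "\<epsilon> * r - \<epsilon> / 2 \<le> t \<longleftrightarrow> r - 1 / 2 \<le> t / \<epsilon>"
    "t < \<epsilon> * r + \<epsilon> / 2 \<longleftrightarrow> t / \<epsilon> < r + 1 / 2" for r t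
    by (simp_all only: pos_le_divide_eq[OF assms] pos_divide_less_eq[OF assms])
  have shift: "r - 1 / 2 \<le> s \<and> s < r + 1 / 2 \<longleftrightarrow> r \<le> s + 1 / 2 \<and> s + 1 / 2 < r + 1"
    for r s :: real
    by (rule iffI; linarith)
  have "\<epsilon> * real_of_int k - \<epsilon> / 2 \<le> t \<and> t < \<epsilon> * real_of_int k + \<epsilon> / 2 \<longleftrightarrow>
      k = \<lfloor>t / \<epsilon> + 1 / 2\<rfloor>" for k t
    unfolding scale shift eq_commute[of k] floor_eq_iff ..
  then show ?thesis
    unfolding cube_def vec_eq_iff mem_Collect_eq vec_lambda_beta by (simp only:)
qed

lemma ex1_cube:
  assumes "\<epsilon> > 0"
  shows "\<exists>!z. x \<in> cube \<epsilon> z"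
  by (simp only: cube_iff_floor[OF assms] ex1_eq)

text \<open>Conditional expectation onto the sigma-algebra generated by the cubes of side \<open>\<epsilon>\<close>.\<close>
definition cube_exp :: "real \<Rightarrow> (real ^ 'n \<Rightarrow> real) \<Rightarrow> real ^ 'n \<Rightarrow> real" where
  "cube_exp \<epsilon> a x =
     (LINT y:cube \<epsilon> (THE z. x \<in> cube \<epsilon> z)|lborel. a y) / \<epsilon> ^ CARD('n)"

text \<open>
  Convolution with the measure \<open>\<Sum>z. k z \<cdot> \<delta>(\<epsilon> z)\<close>, where \<open>k z\<close> is the integral of \<open>\<kappa>\<close> over the cube
  at \<open>z\<close>. For a kernel \<open>\<kappa>\<close> only finitely many summands are nonzero.
\<close>
definition discrete_conv :: "real \<Rightarrow> (real ^ 'n \<Rightarrow> real) \<Rightarrow> (real ^ 'n \<Rightarrow> real) \<Rightarrow>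
    real ^ 'n \<Rightarrow> real" where
  "discrete_conv \<epsilon> \<kappa> b x =
     (\<Sum>\<^sub>\<infinity>z. (LINT y:cube \<epsilon> z|lborel. \<kappa> y) * b (x - \<epsilon> *\<^sub>R lattice_point z))"

definition discrete_RealLife :: "real \<times> real \<times> real \<times> real \<Rightarrow> (real ^ 'n \<Rightarrow> real) \<Rightarrow> real \<Rightarrow>
    (real ^ 'n \<Rightarrow> real) \<Rightarrow> real ^ 'n \<Rightarrow> real" where
  "discrete_RealLife \<theta> \<kappa> \<epsilon> a =
     (let b = cube_exp \<epsilon> a in life_rule \<theta> b (discrete_conv \<epsilon> \<kappa> b))"


text \<open>
  The first four conjuncts state the presuppositions of the notion: all maps are well defined on
  \<open>L\<^sup>1\<close>, and \<open>A\<close> is a shift-invariant subset of \<open>L\<^sup>1\<close>.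
\<close>
definition evolves_to :: "(nat \<Rightarrow> (real ^ 'n \<Rightarrow> real) \<Rightarrow> (real ^ 'n \<Rightarrow> real)) \<Rightarrow>
    ((real ^ 'n \<Rightarrow> real) \<Rightarrow> (real ^ 'n \<Rightarrow> real)) \<Rightarrow> (real ^ 'n \<Rightarrow> real) set \<Rightarrow> bool" where
  "evolves_to \<Phi>n \<Phi> A \<longleftrightarrow>
     (\<forall>n. L1_map (\<Phi>n n)) \<and> L1_map \<Phi> \<and> L1_subset A \<and> shift_invariant A \<and>
     (\<forall>an a. (\<forall>n. an n \<in> L1) \<longrightarrow> a \<in> A \<longrightarrow> (\<lambda>n. L1_norm (\<lambda>x. an n x - a x)) \<longlonglongrightarrow> 0 \<longrightarrow>
        ((\<forall>n. \<Phi>n n (an n) \<doteq> an n) \<longrightarrow> \<Phi> a \<doteq> a) \<and>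
        (\<forall>P::nat. (\<forall>p<P. (\<Phi> ^^ p) a \<in> A) \<longrightarrow>
           ((\<forall>n. (\<Phi>n n ^^ P) (an n) \<doteq> an n) \<longrightarrow> (\<Phi> ^^ P) a \<doteq> a) \<and>
           (\<forall>vn v. vn \<longlonglongrightarrow> v \<longrightarrow>
              (\<forall>n. (\<Phi>n n ^^ P) (an n) \<doteq> shift (real P *\<^sub>R vn n) (an n)) \<longrightarrow>
              (\<Phi> ^^ P) a \<doteq> shift (real P *\<^sub>R v) a)))"

end

theory Submission
  imports Defs
begin

text \<open>
  Translation is continuous in \<open>L\<^sup>1\<close>. Since \<open>cube_exp \<epsilon>\<close> and convolution with a probability measure are
  contractions, and both differ from their limits only by averaging over translations of size at
  most a multiple of \<open>\<epsilon>\<close>, convergence \<open>a\<^sub>n \<rightarrow> a\<close> yields that the cell averages \<open>b\<^sub>n\<close> converge to \<open>a\<close>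
  and the discrete convolutions \<open>u\<^sub>n\<close> of \<open>b\<^sub>n\<close> converge to \<open>u = \<kappa> * a\<close> in \<open>L\<^sup>1\<close>. For an interval
  \<open>[c, d]\<close> with \<open>c > 0\<close>, the indicators of \<open>u\<^sub>n\<close> and \<open>u\<close> differ only where \<open>u\<close> is within \<open>\<delta>\<close> of an
  endpoint or \<open>\<bar>u\<^sub>n - u\<bar> \<ge> \<delta>\<close>; the first set has small measure because \<open>u\<close> avoids the endpoints
  a.e., the second by Markov's inequality. Hence one step of the discrete automata converges along
  any sequence converging to a generic configuration. Iterating this step, travelling-wave
  equations pass to the limit by continuity of translation.
\<close>

subsection \<open>The norm and translations\<close>

lemma L1_borel_measurable: "f \<in> L1 \<Longrightarrow> f \<in> borel_measurable borel"
  by (auto simp: L1_def dest: borel_measurable_integrable)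

lemma L1_iff_norm_finite: "f \<in> L1 \<longleftrightarrow> f \<in> borel_measurable borel \<and> L1_norm f < \<infinity>"
  by (simp add: L1_def L1_norm_def integrable_iff_bounded)

lemma L1_norm_cong_AE: "f \<doteq> g \<Longrightarrow> L1_norm f = L1_norm g"
  unfolding L1_norm_def L1_eq_def by (intro nn_integral_cong_AE) auto

lemma L1_norm_diff_eq_0_iff:
  assumes [measurable]: "f \<in> borel_measurable borel" "g \<in> borel_measurable borel"
  shows "L1_norm (\<lambda>x. f x - g x) = 0 \<longleftrightarrow> f \<doteq> g"
  unfolding L1_norm_def L1_eq_def by (subst nn_integral_0_iff_AE) auto

lemma L1_norm_diff_commute: "L1_norm (\<lambda>x. f x - g x) = L1_norm (\<lambda>x. g x - f x)"
  unfolding L1_norm_def by (simp add: abs_minus_commute)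

text \<open>The hypothesis is a pointwise bound so that one rule serves differences, uniqueness of
  limits, and the sum case of continuity of translation.\<close>

lemma L1_norm_triangle:
  assumes [measurable]: "f \<in> borel_measurable borel" "g \<in> borel_measurable borel"
    and le: "\<And>x. \<bar>u x\<bar> \<le> \<bar>f x\<bar> + \<bar>g x\<bar>"
  shows "L1_norm u \<le> L1_norm f + L1_norm g"
proof -
  have "L1_norm u \<le> (\<integral>\<^sup>+x. ennreal \<bar>f x\<bar> + ennreal \<bar>g x\<bar> \<partial>lborel)"
    unfolding L1_norm_def
    by (intro nn_integral_mono) (use le in \<open>simp flip: ennreal_plus\<close>)
  also have "\<dots> = L1_norm f + L1_norm g"
    unfolding L1_norm_def by (rule nn_integral_add) auto
  finally show ?thesis .
qed

lemma L1_norm_diff_triangle: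
  assumes [measurable]: "f \<in> borel_measurable borel" "g \<in> borel_measurable borel"
    "h \<in> borel_measurable borel"
  shows "L1_norm (\<lambda>x. f x - h x) \<le> L1_norm (\<lambda>x. f x - g x) + L1_norm (\<lambda>x. g x - h x)"
  by (rule L1_norm_triangle) auto

lemma L1_limit_unique:
  assumes [measurable]: "\<And>n::nat. f n \<in> borel_measurable borel" "g \<in> borel_measurable borel"
    "h \<in> borel_measurable borel"
    and g: "(\<lambda>n. L1_norm (\<lambda>x. f n x - g x)) \<longlonglongrightarrow> 0"
    and h: "(\<lambda>n. L1_norm (\<lambda>x. f n x - h x)) \<longlonglongrightarrow> 0"
  shows "g \<doteq> h"
proof -
  have "L1_norm (\<lambda>x. g x - h x) \<le> L1_norm (\<lambda>x. f n x - g x) + L1_norm (\<lambda>x. f n x - h x)" for n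
    by (rule L1_norm_triangle) auto
  then have "L1_norm (\<lambda>x. g x - h x) \<le> 0"
    using tendsto_add[OF g h] by (intro LIMSEQ_le_const) auto
  then show ?thesis
    by (simp add: L1_norm_diff_eq_0_iff)
qed

lemma nn_integral_lborel_translate:
  fixes f :: "real ^ 'n \<Rightarrow> ennreal"
  assumes [measurable]: "f \<in> borel_measurable borel"
  shows "(\<integral>\<^sup>+x. f (x + h) \<partial>lborel) = (\<integral>\<^sup>+x. f x \<partial>lborel)"
proof -
  have "(\<integral>\<^sup>+x. f x \<partial>lborel) = (\<integral>\<^sup>+x. f x \<partial>distr lborel borel ((+) h))"
    by (simp add: lborel_distr_plus)
  also have "\<dots> = (\<integral>\<^sup>+x. f (h + x) \<partial>lborel)"
    by (rule nn_integral_distr) auto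
  finally show ?thesis by (simp add: add.commute)
qed

lemma L1_norm_translate:
  assumes [measurable]: "f \<in> borel_measurable borel"
  shows "L1_norm (\<lambda>x. f (x + h)) = L1_norm f"
  unfolding L1_norm_def by (rule nn_integral_lborel_translate[where f = "\<lambda>x. ennreal \<bar>f x\<bar>"]) auto

lemma L1_dominated_convergence:
  assumes f: "f \<in> borel_measurable borel" and s: "\<And>i::nat. s i \<in> borel_measurable borel"
    and w: "w \<in> L1" and le: "\<And>i x. \<bar>s i x\<bar> \<le> w x"
    and lim: "\<And>x. (\<lambda>i. s i x) \<longlonglongrightarrow> f x"
  shows "(\<lambda>i. L1_norm (\<lambda>x. f x - s i x)) \<longlonglongrightarrow> 0"
proof -
  \<comment> \<open>Domination already at index 0 forces \<open>w\<close> to be nonnegative, so its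
    extended integral is its norm and hence finite.\<close>
  have "0 \<le> w x" for x using le[of 0 x] by (meson abs_ge_zero order_trans)
  then have "(\<integral>\<^sup>+x. w x \<partial>lborel) < \<infinity>"
    using w by (simp add: L1_iff_norm_finite L1_norm_def)
  then have "(\<lambda>i. (\<integral>\<^sup>+x. norm (f x - s i x) \<partial>lborel)) \<longlonglongrightarrow> 0"
    using f s w le lim
    by (intro nn_integral_dominated_convergence_norm[where w = w])
       (auto dest: L1_borel_measurable)
  then show ?thesis by (simp add: L1_norm_def)
qed

section \<open>Continuity of translation in the mean\<close>

definition L1_shift_continuous :: "(real ^ 'n \<Rightarrow> real) \<Rightarrow> bool" where
  "L1_shift_continuous f \<longleftrightarrow> ((\<lambda>h. L1_norm (\<lambda>x. f (x + h) - f x)) \<longlongrightarrow> 0) (nhds 0)"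

text \<open>A three-epsilon argument: translation preserves the norm, so replacing \<open>f\<close>
  by \<open>g\<close> costs the same amount before and after the shift.\<close>

lemma L1_shift_continuous_approx:
  assumes [measurable]: "f \<in> borel_measurable borel"
    and approx: "\<And>e. 0 < e \<Longrightarrow> \<exists>g \<in> borel_measurable borel. L1_shift_continuous g \<and>
      L1_norm (\<lambda>x. f x - g x) < ennreal e"
  shows "L1_shift_continuous f"
  unfolding L1_shift_continuous_def
proof (rule tendsto_zero_ennreal)
  fix r :: real assume "0 < r"
  then obtain g where [measurable]: "g \<in> borel_measurable borel" and g: "L1_shift_continuous g"
    and fg: "L1_norm (\<lambda>x. f x - g x) < ennreal (r / 3)"
    using approx[of "r / 3"] by auto
  from g have "\<forall>\<^sub>F h in nhds 0. L1_norm (\<lambda>x. g (x + h) - g x) < ennreal (r / 3)"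
    unfolding L1_shift_continuous_def by (rule order_tendstoD) (use \<open>0 < r\<close> in simp)
  then show "\<forall>\<^sub>F h in nhds 0. L1_norm (\<lambda>x. f (x + h) - f x) < ennreal r"
  proof eventually_elim
    case (elim h)
    have "L1_norm (\<lambda>x. f (x + h) - f x) \<le>
        L1_norm (\<lambda>x. f (x + h) - g (x + h)) + L1_norm (\<lambda>x. g (x + h) - f x)"
      by (rule L1_norm_diff_triangle) measurable
    also have "L1_norm (\<lambda>x. g (x + h) - f x) \<le>
        L1_norm (\<lambda>x. g (x + h) - g x) + L1_norm (\<lambda>x. g x - f x)"
      by (rule L1_norm_diff_triangle) measurable
    also have "L1_norm (\<lambda>x. f (x + h) - g (x + h)) = L1_norm (\<lambda>x. f x - g x)"
      by (rule L1_norm_translate[where f = "\<lambda>x. f x - g x"]) measurable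
    also have "L1_norm (\<lambda>x. g x - f x) = L1_norm (\<lambda>x. f x - g x)"
      by (rule L1_norm_diff_commute)
    finally have "L1_norm (\<lambda>x. f (x + h) - f x) \<le> L1_norm (\<lambda>x. f x - g x) +
        (L1_norm (\<lambda>x. g (x + h) - g x) + L1_norm (\<lambda>x. f x - g x))"
      by (simp add: add_left_mono)
    also have "\<dots> < ennreal (r / 3) + (ennreal (r / 3) + ennreal (r / 3))"
      using fg elim by (intro add_strict_mono)
    also have "\<dots> = ennreal r"
      using \<open>0 < r\<close> by (simp flip: ennreal_plus)
    finally show ?case .
  qed
qed

text \<open>This closure under dominated pointwise limits carries the property from continuous
  cutoffs to compact sets, from compact to closed sets, and through the limit case of the induction
  on integrable functions.\<close>

lemma L1_shift_continuous_dominated: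
  assumes f: "f \<in> borel_measurable borel" and s: "\<And>i::nat. s i \<in> borel_measurable borel"
    and sc: "\<And>i. L1_shift_continuous (s i)"
    and w: "w \<in> L1" and le: "\<And>i x. \<bar>s i x\<bar> \<le> w x"
    and lim: "\<And>x. (\<lambda>i. s i x) \<longlonglongrightarrow> f x"
  shows "L1_shift_continuous f"
proof (rule L1_shift_continuous_approx[OF f])
  fix e :: real assume "0 < e"
  then have "\<forall>\<^sub>F i in sequentially. L1_norm (\<lambda>x. f x - s i x) < ennreal e"
    using order_tendstoD(2)[OF L1_dominated_convergence[OF f s w le lim]] by simp
  then obtain i where "L1_norm (\<lambda>x. f x - s i x) < ennreal e"
    using eventually_happens'[OF sequentially_bot] by blast
  then show "\<exists>g \<in> borel_measurable borel. L1_shift_continuous g \<and>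
      L1_norm (\<lambda>x. f x - g x) < ennreal e"
    using s sc by blast
qed

lemma L1_indicator:
  "A \<in> sets borel \<Longrightarrow> emeasure lborel A < \<infinity> \<Longrightarrow> (\<lambda>x. indicator A x * c) \<in> L1"
  by (simp add: L1_def)

text \<open>Along a sequence of shifts tending to 0 the differences vanish pointwise by continuity.
  Shifts shorter than 1 keep them supported in the ball of radius \<open>r + 1\<close>, where
  \<open>2 * B\<close> dominates.\<close>

lemma L1_shift_continuous_compact_support:
  fixes g :: "real ^ 'n \<Rightarrow> real"
  assumes cont: "continuous_on UNIV g" and le: "\<And>x. \<bar>g x\<bar> \<le> B"
    and supp: "\<And>x. norm x > r \<Longrightarrow> g x = 0"
  shows "L1_shift_continuous g"
proof -
  have [measurable]: "g \<in> borel_measurable borel"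
    by (rule borel_measurable_continuous_onI[OF cont])
  have "0 \<le> B" using le[of 0] by linarith
  have "((\<lambda>h. L1_norm (\<lambda>x. g (x + h) - g x)) \<longlongrightarrow> 0) (at 0)"
    unfolding tendsto_at_iff_sequentially
  proof (intro allI impI)
    fix X :: "nat \<Rightarrow> real ^ 'n" assume "X \<longlonglongrightarrow> 0"
    then have "\<forall>\<^sub>F i in sequentially. norm (X i) < 1"
      by (intro order_tendstoD(2)[of _ "0::real"] tendsto_norm_zero) auto
    then obtain N where N: "\<And>i. i \<ge> N \<Longrightarrow> norm (X i) < 1"
      by (auto simp: eventually_sequentially)
    \<comment> \<open>The differences play the role of the approximants, with limit function 0. The
      offset \<open>N\<close> makes the domination hold from the first index on.\<close>
    have "(\<lambda>i. L1_norm (\<lambda>x. 0 - (g (x + X (i + N)) - g x))) \<longlonglongrightarrow> 0"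
    proof (rule L1_dominated_convergence)
      show "(\<lambda>x :: real ^ 'n. indicator (cball 0 (r + 1)) x * (2 * B)) \<in> L1"
        using emeasure_lborel_cball_finite[of "0 :: real ^ 'n" "r + 1"] by (intro L1_indicator) simp_all
      show "\<bar>g (x + X (i + N)) - g x\<bar> \<le> indicator (cball 0 (r + 1)) x * (2 * B)" for i x
      proof (cases "norm x \<le> r + 1")
        case True
        then show ?thesis using le[of x] le[of "x + X (i + N)"] by simp
      next
        case False
        have "norm x \<le> norm (x + X (i + N)) + norm (X (i + N))"
          by (metis add_diff_cancel_right' norm_triangle_ineq4)
        then have "norm (x + X (i + N)) > r" using False N[of "i + N"] by simp
        then show ?thesis using False by (simp add: supp)
      qed
      show "(\<lambda>i. g (x + X (i + N)) - g x) \<longlonglongrightarrow> 0" for x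
      proof -
        have "(\<lambda>i. x + X (i + N)) \<longlonglongrightarrow> x + 0"
          by (intro tendsto_add tendsto_const LIMSEQ_ignore_initial_segment) fact
        then have "(\<lambda>i. g (x + X (i + N))) \<longlonglongrightarrow> g x"
          using cont by (intro continuous_on_tendsto_compose[OF cont]) auto
        then show ?thesis by (simp add: LIM_zero)
      qed
    qed auto
    then have "(\<lambda>i. L1_norm (\<lambda>x. g (x + X (i + N)) - g x)) \<longlonglongrightarrow> 0"
      by (simp add: L1_norm_def abs_minus_commute)
    then show "((\<lambda>h. L1_norm (\<lambda>x. g (x + h) - g x)) \<circ> X) \<longlonglongrightarrow> 0"
      unfolding comp_def
      by (rule LIMSEQ_offset[where f = "\<lambda>i. L1_norm (\<lambda>x. g (x + X i) - g x)"])
  qed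
  \<comment> \<open>The punctured limit extends to \<open>nhds 0\<close> because the value at the
    zero shift is 0.\<close>
  moreover have "L1_norm (\<lambda>x. g (x + 0) - g x) = 0"
    by (simp add: L1_norm_def)
  ultimately show ?thesis
    unfolding L1_shift_continuous_def
    using tendsto_at_iff_tendsto_nhds[of "\<lambda>h. L1_norm (\<lambda>x. g (x + h) - g x)" 0] by simp
qed

text \<open>The functions \<open>s i\<close> are 1 on \<open>K\<close> and decrease linearly, with
  slope \<open>Suc i\<close>, in the distance to \<open>K\<close>; they tend to the indicator
  because \<open>K\<close> is closed. The empty set is treated apart, since \<open>infdist\<close>
  to it is 0 by convention and every \<open>s i\<close> would be constantly 1.\<close>

lemma L1_shift_continuous_compact:
  assumes "compact K"
  shows "L1_shift_continuous (indicator K :: real ^ 'n \<Rightarrow> real)"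
proof (cases "K = {}")
  case True
  then show ?thesis by (simp add: L1_shift_continuous_def L1_norm_def)
next
  case False
  obtain r where r: "\<And>x. x \<in> K \<Longrightarrow> norm x \<le> r"
    using compact_imp_bounded[OF assms] by (auto simp: bounded_iff)
  define s :: "nat \<Rightarrow> real ^ 'n \<Rightarrow> real" where
    "s i x = max 0 (1 - real (Suc i) * infdist x K)" for i x
  have cont: "continuous_on UNIV (s i)" for i
    unfolding s_def by (intro continuous_intros)
  have supp: "s i x = 0" if "norm x > r + 1" for i x
  proof -
    obtain y where y: "y \<in> K" "infdist x K = dist x y"
      using infdist_attains_inf[OF compact_imp_closed[OF assms] False] by blast
    have "norm x \<le> norm (x - y) + norm y"
      by (metis diff_add_cancel norm_triangle_ineq)
    \<comment> \<open>All slopes are at least 1, so every \<open>s i\<close> vanishes at distance 1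
      or more from \<open>K\<close>; this gives one ball supporting them all.\<close>
    then have "1 \<le> infdist x K"
      using that r[OF y(1)] y(2) by (simp add: dist_norm)
    then have "1 * 1 \<le> real (Suc i) * infdist x K" by (intro mult_mono) auto
    then show ?thesis by (simp add: s_def)
  qed
  have bound: "\<bar>s i x\<bar> \<le> 1" for i x
    using infdist_nonneg[of x K] by (simp add: s_def)
  show ?thesis
  proof (rule L1_shift_continuous_dominated)
    show "s i \<in> borel_measurable borel" for i
      by (rule borel_measurable_continuous_onI[OF cont])
    show "indicator K \<in> borel_measurable borel"
      using assms by (intro borel_measurable_indicator) (simp add: borel_compact)
    show "L1_shift_continuous (s i)" for i
      by (rule L1_shift_continuous_compact_support[OF cont bound supp])
    show "(\<lambda>x :: real ^ 'n. indicator (cball 0 (r + 1)) x * 1) \<in> L1"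
      using emeasure_lborel_cball_finite[of "0 :: real ^ 'n" "r + 1"] by (intro L1_indicator) simp_all
    show "\<bar>s i x\<bar> \<le> indicator (cball 0 (r + 1)) x * 1" for i x
      using bound[of i x] supp[of x i] by (auto simp: indicator_def not_le)
    show "(\<lambda>i. s i x) \<longlonglongrightarrow> indicator K x" for x
    proof (cases "x \<in> K")
      case True
      then show ?thesis by (simp add: s_def)
    next
      case notin: False
      then have pos: "infdist x K > 0"
        using in_closed_iff_infdist_zero[OF compact_imp_closed[OF assms] False] infdist_nonneg[of x K]
        by force
      obtain N where N: "1 / infdist x K < real N"
        using reals_Archimedean2 by blast
      have "\<forall>\<^sub>F i in sequentially. s i x = 0"
        using eventually_ge_at_top[of N]
      proof eventually_elim
        case (elim i)
        then have "1 / infdist x K \<le> real (Suc i)" using N by linarith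
        then have "1 \<le> real (Suc i) * infdist x K"
          by (simp only: pos_divide_le_eq[OF pos])
        then show ?case by (simp add: s_def)
      qed
      then show ?thesis using notin by (simp add: tendsto_eventually)
    qed
  qed
qed

text \<open>Cutting \<open>T\<close> with growing balls gives compact sets, and finite measure makes
  the indicator of \<open>T\<close> itself the dominating function.\<close>

lemma L1_shift_continuous_closed:
  fixes T :: "(real ^ 'n) set"
  assumes "closed T" "emeasure lborel T < \<infinity>"
  shows "L1_shift_continuous (indicator T :: real ^ 'n \<Rightarrow> real)"
proof (rule L1_shift_continuous_dominated)
  show "(\<lambda>x. indicator T x * 1) \<in> L1"
    using assms by (intro L1_indicator) auto
  show "L1_shift_continuous (indicator (T \<inter> cball 0 (real i)) :: real ^ 'n \<Rightarrow> real)" for i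
    by (intro L1_shift_continuous_compact closed_Int_compact assms compact_cball)
  show "(\<lambda>i. indicator (T \<inter> cball 0 (real i)) x :: real) \<longlonglongrightarrow> indicator T x" for x
  proof (rule tendsto_eventually)
    obtain N where "norm x \<le> real N" using real_arch_simple by blast
    then show "\<forall>\<^sub>F i in sequentially. (indicator (T \<inter> cball 0 (real i)) x :: real) = indicator T x"
      by (intro eventually_sequentiallyI[of N]) (auto simp: indicator_def)
  qed
  show "indicator T \<in> borel_measurable borel"
    "indicator (T \<inter> cball 0 (real i)) \<in> borel_measurable borel" for i
    using assms by (auto intro!: borel_measurable_indicator)
qed (auto simp: indicator_def)

text \<open>Induction on integrable functions reduces the claim to indicators of Borel sets of
  finite measure; these are approximated in norm by closed subsets through inner regularity.\<close>

theorem L1_shift_continuous: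
  fixes f :: "real ^ 'n \<Rightarrow> real"
  assumes "f \<in> L1"
  shows "L1_shift_continuous f"
proof -
  have "integrable lborel f" using assms by (simp add: L1_def)
  then show ?thesis
  proof induction
    case (base A c)
    have A[measurable]: "A \<in> sets borel" using base by simp
    have *: "L1_shift_continuous (indicator A :: real ^ 'n \<Rightarrow> real)"
    proof (rule L1_shift_continuous_approx)
      fix e :: real assume "0 < e"
      \<comment> \<open>Inner regularity is stated for Lebesgue measure, which agrees with
        \<open>lborel\<close> on Borel sets.\<close>
      have "A \<in> sets lebesgue" using A by (simp add: sets_completionI_sets)
      then obtain T where T: "closed T" "T \<subseteq> A" "emeasure lebesgue (A - T) < ennreal e"
        using sets_lebesgue_inner_closed[OF _ \<open>0 < e\<close>] by metis
      have [measurable]: "T \<in> sets borel" using T by simp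
      have "L1_norm (\<lambda>x. indicator A x - indicator T x) =
          (\<integral>\<^sup>+x. indicator (A - T) x \<partial>lborel)"
        unfolding L1_norm_def
        by (intro nn_integral_cong) (use T(2) in \<open>auto simp: indicator_def\<close>)
      also have "\<dots> = emeasure lebesgue (A - T)" by simp
      finally have "L1_norm (\<lambda>x. indicator A x - indicator T x) < ennreal e" using T by simp
      moreover have "emeasure lborel T < \<infinity>"
        using emeasure_mono[OF T(2), of lborel] base(2) by (simp add: order_le_less_trans)
      ultimately show "\<exists>g \<in> borel_measurable borel. L1_shift_continuous g \<and>
          L1_norm (\<lambda>x. indicator A x - g x) < ennreal e"
        using L1_shift_continuous_closed[OF T(1)]
        by (intro bexI[of _ "indicator T"]) auto
    qed measurable
    have "L1_norm (\<lambda>x. indicator A (x + h) *\<^sub>R c - indicator A x *\<^sub>R c) =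
        ennreal \<bar>c\<bar> * L1_norm (\<lambda>x. indicator A (x + h) - indicator A x)" for h :: "real ^ 'n"
    proof -
      have "L1_norm (\<lambda>x. indicator A (x + h) *\<^sub>R c - indicator A x *\<^sub>R c) =
        (\<integral>\<^sup>+x. ennreal \<bar>c\<bar> * ennreal \<bar>indicator A (x + h) - indicator A x\<bar> \<partial>lborel)"
        unfolding L1_norm_def
        by (intro nn_integral_cong, subst ennreal_mult''[symmetric])
           (simp_all add: mult.commute[of _ c] flip: abs_mult right_diff_distrib)
      also have "\<dots> = ennreal \<bar>c\<bar> * L1_norm (\<lambda>x. indicator A (x + h) - indicator A x)"
        unfolding L1_norm_def by (rule nn_integral_cmult) measurable
      finally show ?thesis .
    qed
    moreover have "((\<lambda>h. ennreal \<bar>c\<bar> * L1_norm (\<lambda>x. indicator A (x + h) - indicator A x))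
        \<longlongrightarrow> ennreal \<bar>c\<bar> * 0) (nhds (0::real ^ 'n))"
      using * unfolding L1_shift_continuous_def
      by (intro ennreal_tendsto_cmult) auto
    ultimately show ?case by (simp add: L1_shift_continuous_def)
  next
    case (add f g)
    have [measurable]: "f \<in> borel_measurable borel" "g \<in> borel_measurable borel"
      using add(1,2) by (auto dest: borel_measurable_integrable)
    have "((\<lambda>h. L1_norm (\<lambda>x. f (x + h) - f x) + L1_norm (\<lambda>x. g (x + h) - g x))
        \<longlongrightarrow> 0 + 0) (nhds 0)"
      using add by (intro tendsto_add) (auto simp: L1_shift_continuous_def)
    then have lim: "((\<lambda>h. L1_norm (\<lambda>x. f (x + h) - f x) + L1_norm (\<lambda>x. g (x + h) - g x))
        \<longlongrightarrow> 0) (nhds 0)" by simp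
    have le: "L1_norm (\<lambda>x. f (x + h) + g (x + h) - (f x + g x)) \<le>
        L1_norm (\<lambda>x. f (x + h) - f x) + L1_norm (\<lambda>x. g (x + h) - g x)" for h
      by (rule L1_norm_triangle) auto
    show ?case unfolding L1_shift_continuous_def
      by (rule tendsto_sandwich[OF _ _ tendsto_const lim]) (use le in auto)
  next
    case (lim f s)
    show ?case
    proof (rule L1_shift_continuous_dominated)
      show "f \<in> borel_measurable borel" "s i \<in> borel_measurable borel" for i
        using lim(1,4)[THEN borel_measurable_integrable] by simp_all
      show "(\<lambda>x. 2 * \<bar>f x\<bar>) \<in> L1"
        using lim(4) by (simp add: L1_def)
      show "L1_shift_continuous (s i)" "\<bar>s i x\<bar> \<le> 2 * \<bar>f x\<bar>" "(\<lambda>i. s i x) \<longlonglongrightarrow> f x" for i x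
        using lim by simp_all
    qed
  qed
qed

text \<open>Minkowski's integral inequality in weighted form, by exchanging the integrals. Where
  \<open>w\<close> vanishes the integrand is 0, so the uniform bound \<open>c\<close> is asked only
  on the support of the weight; for cell averages this restricts it to small shifts.\<close>

lemma L1_norm_Minkowski:
  fixes w :: "real ^ 'n \<Rightarrow> ennreal" and F :: "real ^ 'n \<Rightarrow> real ^ 'm \<Rightarrow> real"
  assumes [measurable]: "w \<in> borel_measurable borel"
    "(\<lambda>p. F (fst p) (snd p)) \<in> borel_measurable (borel \<Otimes>\<^sub>M borel)"
    and u: "\<And>x. ennreal \<bar>u x\<bar> \<le> (\<integral>\<^sup>+y. w y * ennreal \<bar>F y x\<bar> \<partial>lborel)"
    and c: "\<And>y. w y \<noteq> 0 \<Longrightarrow> L1_norm (F y) \<le> c"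
  shows "L1_norm u \<le> (\<integral>\<^sup>+y. w y \<partial>lborel) * c"
proof -
  have "L1_norm u \<le> (\<integral>\<^sup>+x. \<integral>\<^sup>+y. w y * ennreal \<bar>F y x\<bar> \<partial>lborel \<partial>lborel)"
    unfolding L1_norm_def by (intro nn_integral_mono u)
  also have "\<dots> = (\<integral>\<^sup>+y. \<integral>\<^sup>+x. w y * ennreal \<bar>F y x\<bar> \<partial>lborel \<partial>lborel)"
    by (rule lborel_pair.Fubini') (simp add: case_prod_unfold)
  also have "\<dots> = (\<integral>\<^sup>+y. w y * L1_norm (F y) \<partial>lborel)"
    unfolding L1_norm_def
  proof (intro nn_integral_cong nn_integral_cmult)
    show "(\<lambda>x. ennreal \<bar>F y x\<bar>) \<in> borel_measurable lborel" for y
      using measurable_compose[OF measurable_Pair1' assms(2), of y] by simp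
  qed
  also have "\<dots> \<le> (\<integral>\<^sup>+y. w y * c \<partial>lborel)"
    using c by (intro nn_integral_mono) (metis mult_left_mono mult_zero_left order_refl zero_le)
  also have "\<dots> = (\<integral>\<^sup>+y. w y \<partial>lborel) * c"
    by (rule nn_integral_multc) simp
  finally show ?thesis .
qed

lemma abs_integral_le_nn_integral:
  fixes f :: "'a \<Rightarrow> real"
  shows "ennreal \<bar>\<integral>x. f x \<partial>M\<bar> \<le> (\<integral>\<^sup>+x. ennreal \<bar>f x\<bar> \<partial>M)"
proof (cases "integrable M f")
  case True
  then show ?thesis using integral_norm_bound_ennreal[OF True] by simp
\<comment> \<open>A non-integrable function has Bochner integral 0 by convention, so the bound is
  trivial in this case.\<close>
qed (simp add: not_integrable_integral_eq)

subsection \<open>Grid cubes and conditional expectation\<close>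

text \<open>Componentwise rounding to the nearest integer after scaling. Ties go upwards because the
  cubes contain their lower faces.\<close>

definition grid_index :: "real \<Rightarrow> real ^ 'n \<Rightarrow> int ^ 'n" where
  "grid_index \<epsilon> x = (\<chi> i. \<lfloor>x $ i / \<epsilon> + 1 / 2\<rfloor>)"

text \<open>The centre of the cube containing \<open>x\<close>.\<close>

definition grid_round :: "real \<Rightarrow> real ^ 'n \<Rightarrow> real ^ 'n" where
  "grid_round \<epsilon> x = \<epsilon> *\<^sub>R lattice_point (grid_index \<epsilon> x)"

lemma mem_cube_iff: "\<epsilon> > 0 \<Longrightarrow> x \<in> cube \<epsilon> z \<longleftrightarrow> grid_index \<epsilon> x = z"
  by (auto simp: cube_iff_floor grid_index_def)

lemma the_cube: "\<epsilon> > 0 \<Longrightarrow> (THE z. x \<in> cube \<epsilon> z) = grid_index \<epsilon> x"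
  by (simp add: mem_cube_iff)

lemma cube_measurable[measurable]: "cube \<epsilon> z \<in> sets borel"
proof -
  have "cube \<epsilon> z = {x \<in> space borel. \<forall>i. \<epsilon> * real_of_int (z $ i) - \<epsilon> / 2 \<le> x $ i \<and>
      x $ i < \<epsilon> * real_of_int (z $ i) + \<epsilon> / 2}"
    by (simp add: cube_def)
  also have "\<dots> \<in> sets borel" by measurable
  finally show ?thesis .
qed

text \<open>The half-open cube lies between an open and a closed box with the same corners, and
  these have equal volume.\<close>

lemma emeasure_cube:
  fixes z :: "int ^ 'n"
  assumes "\<epsilon> > 0"
  shows "emeasure lborel (cube \<epsilon> z) = ennreal (\<epsilon> ^ CARD('n))"
proof (rule antisym)
  define l u :: "real ^ 'n" where "l = (\<chi> i. \<epsilon> * real_of_int (z $ i) - \<epsilon> / 2)"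
    and "u = (\<chi> i. \<epsilon> * real_of_int (z $ i) + \<epsilon> / 2)"
  have side: "(u - l) \<bullet> b = \<epsilon>" if "b \<in> Basis" for b
    using that by (auto simp: Basis_vec_def inner_axis u_def l_def)
  then have le: "l \<bullet> b \<le> u \<bullet> b" if "b \<in> Basis" for b
    using that assms by (metis diff_ge_0_iff_ge inner_diff_left less_imp_le)
  have prod: "(\<Prod>b\<in>Basis. (u - l) \<bullet> b) = \<epsilon> ^ CARD('n)"
    using side by simp
  have "cube \<epsilon> z \<subseteq> cbox l u"
    by (simp add: cube_def mem_box_cart l_def u_def subset_iff) (meson less_imp_le)
  moreover have "box l u \<subseteq> cube \<epsilon> z"
    by (simp add: cube_def mem_box_cart l_def u_def subset_iff) (meson less_imp_le)
  ultimately have "cube \<epsilon> z \<subseteq> cbox l u" "box l u \<subseteq> cube \<epsilon> z" .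
  note this[THEN emeasure_mono, of lborel]
  then show "emeasure lborel (cube \<epsilon> z) \<le> ennreal (\<epsilon> ^ CARD('n))"
    "ennreal (\<epsilon> ^ CARD('n)) \<le> emeasure lborel (cube \<epsilon> z)"
    using le by (simp_all add: prod)
qed

lemma grid_index_measurable[measurable]:
  assumes "\<epsilon> > 0"
  shows "(grid_index \<epsilon> :: real ^ 'n \<Rightarrow> _) \<in> borel \<rightarrow>\<^sub>M count_space UNIV"
proof -
  have "grid_index \<epsilon> -` {z} = cube \<epsilon> z" for z :: "int ^ 'n"
    using mem_cube_iff[OF assms] by auto
  then show ?thesis
    by (subst measurable_count_space_eq2_countable) (simp_all add: cube_measurable)
qed

lemma grid_round_measurable[measurable]:
  assumes "\<epsilon> > 0"
  shows "grid_round \<epsilon> \<in> borel \<rightarrow>\<^sub>M borel"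
  unfolding grid_round_def
  by (rule measurable_compose[OF grid_index_measurable[OF assms]]) simp

lemma same_cube_dist:
  assumes "x \<in> cube \<epsilon> z" "y \<in> cube \<epsilon> z"
  shows "\<bar>(x - y) $ i\<bar> < \<epsilon>"
proof -
  have "\<epsilon> * real_of_int (z $ i) - \<epsilon> / 2 \<le> x $ i" "x $ i < \<epsilon> * real_of_int (z $ i) + \<epsilon> / 2"
    "\<epsilon> * real_of_int (z $ i) - \<epsilon> / 2 \<le> y $ i" "y $ i < \<epsilon> * real_of_int (z $ i) + \<epsilon> / 2"
    using assms by (auto simp: cube_def)
  then show ?thesis unfolding vector_minus_component by argo
qed

lemma grid_round_dist:
  assumes "\<epsilon> > 0"
  shows "\<bar>(x - grid_round \<epsilon> x) $ i\<bar> < \<epsilon>"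
proof (rule same_cube_dist)
  show "x \<in> cube \<epsilon> (grid_index \<epsilon> x)" by (simp add: mem_cube_iff assms)
  show "grid_round \<epsilon> x \<in> cube \<epsilon> (grid_index \<epsilon> x)"
    using assms by (simp add: cube_def grid_round_def lattice_point_def)
qed

lemma norm_less_of_components:
  fixes h :: "real ^ 'n"
  assumes "\<And>i. \<bar>h $ i\<bar> < \<epsilon>"
  shows "norm h < real CARD('n) * \<epsilon>"
proof -
  have "norm h \<le> (\<Sum>i\<in>UNIV. \<bar>h $ i\<bar>)" by (rule norm_le_l1_cart)
  also have "\<dots> < (\<Sum>i\<in>(UNIV :: 'n set). \<epsilon>)"
    by (rule sum_strict_mono) (use assms in auto)
  finally show ?thesis by simp
qed

lemma cube_exp_eq:
  fixes a :: "real ^ 'n \<Rightarrow> real"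
  assumes "\<epsilon> > 0"
  shows "cube_exp \<epsilon> a x = (LINT y:cube \<epsilon> (grid_index \<epsilon> x)|lborel. a y) / \<epsilon> ^ CARD('n)"
  unfolding cube_exp_def the_cube[OF assms] ..

lemma cube_exp_measurable[measurable]:
  fixes a :: "real ^ 'n \<Rightarrow> real"
  assumes "\<epsilon> > 0"
  shows "cube_exp \<epsilon> a \<in> borel_measurable borel"
  unfolding cube_exp_eq[OF assms, abs_def]
  by (rule measurable_compose[OF grid_index_measurable[OF assms]]) simp

lemma cube_exp_cong_AE:
  fixes f g :: "real ^ 'n \<Rightarrow> real"
  assumes "\<epsilon> > 0" "f \<in> L1" "g \<in> L1" "f \<doteq> g"
  shows "cube_exp \<epsilon> f = cube_exp \<epsilon> g"
proof
  fix x
  have [measurable]: "f \<in> borel_measurable borel" "g \<in> borel_measurable borel"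
    using assms by (auto intro: L1_borel_measurable)
  have "(LINT y:cube \<epsilon> z|lborel. f y) = (LINT y:cube \<epsilon> z|lborel. g y)" for z
    unfolding set_lebesgue_integral_def using assms(4)
    by (intro integral_cong_AE) (auto simp: L1_eq_def)
  then show "cube_exp \<epsilon> f x = cube_exp \<epsilon> g x"
    by (simp add: cube_exp_eq assms)
qed

lemma L1_set_integrable_cube: "f \<in> L1 \<Longrightarrow> set_integrable lborel (cube \<epsilon> z) f"
  unfolding set_integrable_def L1_def by (intro integrable_mult_indicator) auto

lemma cube_exp_diff:
  assumes "\<epsilon> > 0" "f \<in> L1" "g \<in> L1"
  shows "cube_exp \<epsilon> (\<lambda>x. f x - g x) x = cube_exp \<epsilon> f x - cube_exp \<epsilon> g x"
  by (simp add: cube_exp_eq assms set_integral_diff L1_set_integrable_cube diff_divide_distrib)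

lemma abs_cube_exp_le:
  fixes a :: "real ^ 'n \<Rightarrow> real"
  assumes "\<epsilon> > 0" and [measurable]: "a \<in> borel_measurable borel"
  shows "ennreal \<bar>cube_exp \<epsilon> a x\<bar> \<le>
    (\<integral>\<^sup>+y. indicator (cube \<epsilon> (grid_index \<epsilon> x)) y * ennreal \<bar>a y\<bar> \<partial>lborel) / ennreal (\<epsilon> ^ CARD('n))"
proof -
  have "ennreal \<bar>cube_exp \<epsilon> a x\<bar> =
      ennreal \<bar>LINT y:cube \<epsilon> (grid_index \<epsilon> x)|lborel. a y\<bar> / ennreal (\<epsilon> ^ CARD('n))"
    using assms by (simp add: cube_exp_eq abs_divide divide_ennreal)
  also have "ennreal \<bar>LINT y:cube \<epsilon> (grid_index \<epsilon> x)|lborel. a y\<bar> \<le>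
      (\<integral>\<^sup>+y. ennreal \<bar>indicator (cube \<epsilon> (grid_index \<epsilon> x)) y *\<^sub>R a y\<bar> \<partial>lborel)"
    unfolding set_lebesgue_integral_def by (rule abs_integral_le_nn_integral)
  also have "\<dots> = (\<integral>\<^sup>+y. indicator (cube \<epsilon> (grid_index \<epsilon> x)) y * ennreal \<bar>a y\<bar> \<partial>lborel)"
    by (intro nn_integral_cong) (simp add: indicator_def)
  finally show ?thesis
    by (simp add: divide_right_mono_ennreal)
qed

text \<open>Lying in a common cube is a symmetric relation. After exchanging the integrals, each
  \<open>y\<close> is therefore weighted by the volume of its own cube, which cancels the
  normalising factor.\<close>

lemma L1_norm_cube_exp_le:
  fixes a :: "real ^ 'n \<Rightarrow> real"
  assumes "\<epsilon> > 0" and [measurable]: "a \<in> borel_measurable borel"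
  shows "L1_norm (cube_exp \<epsilon> a) \<le> L1_norm a"
proof -
  let ?v = "ennreal (\<epsilon> ^ CARD('n))"
  have [measurable]: "grid_index \<epsilon> \<in> (borel :: (real ^ 'n) measure) \<rightarrow>\<^sub>M count_space UNIV"
    by (rule grid_index_measurable) fact
  define D where "D = {(x, y). grid_index \<epsilon> y = (grid_index \<epsilon> x :: int ^ 'n)}"
  \<comment> \<open>Writing the relation as a countable union of measurable rectangles gives the
    joint measurability that the exchange of integrals requires.\<close>
  have "D = (\<Union>z. cube \<epsilon> z \<times> cube \<epsilon> z)"
    by (auto simp: D_def mem_cube_iff assms)
  also have "\<dots> \<in> sets (borel \<Otimes>\<^sub>M borel)"
    by (intro sets.countable_UN' pair_measureI cube_measurable) auto
  finally have [measurable]: "D \<in> sets (borel \<Otimes>\<^sub>M borel)" .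
  have v: "?v \<noteq> 0" "?v \<noteq> top" using assms by auto
  have "L1_norm (cube_exp \<epsilon> a) \<le> (\<integral>\<^sup>+x. (\<integral>\<^sup>+y. indicator (cube \<epsilon> (grid_index \<epsilon> x)) y *
      ennreal \<bar>a y\<bar> \<partial>lborel) / ?v \<partial>lborel)"
    unfolding L1_norm_def by (intro nn_integral_mono abs_cube_exp_le assms)
  also have "\<dots> = (\<integral>\<^sup>+x. (\<integral>\<^sup>+y. indicator (cube \<epsilon> (grid_index \<epsilon> x)) y *
      ennreal \<bar>a y\<bar> / ?v \<partial>lborel) \<partial>lborel)"
    by (intro nn_integral_cong nn_integral_divide[symmetric]) measurable
  also have "\<dots> = (\<integral>\<^sup>+x. (\<integral>\<^sup>+y. indicator D (x, y) * ennreal \<bar>a y\<bar> / ?v \<partial>lborel) \<partial>lborel)"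
    by (simp add: D_def indicator_def mem_cube_iff assms)
  also have "\<dots> = (\<integral>\<^sup>+y. (\<integral>\<^sup>+x. indicator D (x, y) * ennreal \<bar>a y\<bar> / ?v \<partial>lborel) \<partial>lborel)"
    by (rule lborel_pair.Fubini') (simp add: case_prod_unfold)
  also have "\<dots> = (\<integral>\<^sup>+y. (\<integral>\<^sup>+x. ennreal \<bar>a y\<bar> / ?v * indicator (cube \<epsilon> (grid_index \<epsilon> y)) x \<partial>lborel)
      \<partial>lborel)"
    by (intro nn_integral_cong) (auto simp: D_def indicator_def mem_cube_iff assms)
  also have "\<dots> = (\<integral>\<^sup>+y. ennreal \<bar>a y\<bar> / ?v * ?v \<partial>lborel)"
    by (simp add: nn_integral_cmult_indicator emeasure_cube assms)
  also have "\<dots> = L1_norm a"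
    unfolding L1_norm_def using v
    by (intro nn_integral_cong) (simp add: ennreal_divide_times divide_mult_eq ennreal_divide_self)
  finally show ?thesis .
qed

lemma cube_exp_L1:
  assumes "\<epsilon> > 0" "a \<in> L1"
  shows "cube_exp \<epsilon> a \<in> L1"
  using assms L1_norm_cube_exp_le[of \<epsilon> a] cube_exp_measurable[of \<epsilon> a]
  by (auto simp: L1_iff_norm_finite intro: order_le_less_trans)

text \<open>The error at \<open>x\<close> averages \<open>a y - a x\<close> over the cube of
  \<open>x\<close>. With \<open>y = x + h\<close>, the shift \<open>h\<close> lies in the open box
  of side \<open>2 * \<epsilon>\<close> around 0, whichever the position of \<open>x\<close> in its
  cube. Enlarging the cube to this box removes the dependence on \<open>x\<close>; the ratio of the
  volumes is the factor \<open>2 ^ CARD('n)\<close>.\<close>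

lemma L1_norm_cube_exp_diff_le:
  fixes a :: "real ^ 'n \<Rightarrow> real"
  assumes "\<epsilon> > 0" "a \<in> L1"
    and c: "\<And>h. (\<And>i. \<bar>h $ i\<bar> < \<epsilon>) \<Longrightarrow> L1_norm (\<lambda>x. a (x + h) - a x) \<le> c"
  shows "L1_norm (\<lambda>x. cube_exp \<epsilon> a x - a x) \<le> 2 ^ CARD('n) * c"
proof -
  let ?v = "ennreal (\<epsilon> ^ CARD('n))"
  let ?B = "box (\<chi> i. - \<epsilon>) (\<chi> i. \<epsilon>) :: (real ^ 'n) set"
  define w :: "real ^ 'n \<Rightarrow> ennreal" where "w h = indicator ?B h / ?v" for h
  have [measurable]: "a \<in> borel_measurable borel" by (rule L1_borel_measurable) fact
  have [measurable]: "w \<in> borel_measurable borel" unfolding w_def by measurable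
  have "L1_norm (\<lambda>x. cube_exp \<epsilon> a x - a x) \<le> (\<integral>\<^sup>+h. w h \<partial>lborel) * c"
  proof (rule L1_norm_Minkowski[where F = "\<lambda>h x. a (x + h) - a x"])
    show "ennreal \<bar>cube_exp \<epsilon> a x - a x\<bar> \<le> (\<integral>\<^sup>+h. w h * ennreal \<bar>a (x + h) - a x\<bar> \<partial>lborel)" for x
    proof -
      let ?C = "cube \<epsilon> (grid_index \<epsilon> x)"
      have fin: "emeasure lborel ?C < \<infinity>" by (simp add: emeasure_cube assms)
      have meas: "measure lborel ?C = \<epsilon> ^ CARD('n)"
        using assms by (simp add: measure_def emeasure_cube)
      \<comment> \<open>Here \<open>x\<close> is fixed and \<open>a x\<close> is a constant, which
        in general is not integrable over the whole space. Linearity is therefore applied on the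
        cube alone instead of through \<open>cube_exp_diff\<close>.\<close>
      have "cube_exp \<epsilon> (\<lambda>y. a y - a x) x =
          ((LINT y:?C|lborel. a y) - (LINT y:?C|lborel. a x)) / \<epsilon> ^ CARD('n)"
        by (subst cube_exp_eq[OF assms(1)], subst set_integral_diff)
           (use fin in \<open>simp_all only: L1_set_integrable_cube assms\<close>, simp add: set_integrable_def)
      also have "\<dots> = cube_exp \<epsilon> a x - a x"
        using assms fin meas by (simp add: cube_exp_eq set_lebesgue_integral_def diff_divide_distrib)
      finally have "ennreal \<bar>cube_exp \<epsilon> a x - a x\<bar> \<le>
          (\<integral>\<^sup>+y. indicator ?C y * ennreal \<bar>a y - a x\<bar> \<partial>lborel) / ?v"
        using abs_cube_exp_le[OF assms(1), of "\<lambda>y. a y - a x" x] by simp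
      also have "\<dots> = (\<integral>\<^sup>+y. indicator ?C y * ennreal \<bar>a y - a x\<bar> / ?v \<partial>lborel)"
        by (rule nn_integral_divide[symmetric]) measurable
      also have "\<dots> = (\<integral>\<^sup>+h. indicator ?C (h + x) * ennreal \<bar>a (h + x) - a x\<bar> / ?v \<partial>lborel)"
        by (rule nn_integral_lborel_translate[symmetric]) measurable
      also have "\<dots> \<le> (\<integral>\<^sup>+h. w h * ennreal \<bar>a (x + h) - a x\<bar> \<partial>lborel)"
      proof (rule nn_integral_mono)
        fix h
        have "h \<in> ?B" if "h + x \<in> ?C"
        proof -
          have "\<bar>(h + x - x) $ i\<bar> < \<epsilon>" for i
            by (rule same_cube_dist[OF that]) (simp add: mem_cube_iff assms)
          then show ?thesis by (auto simp: mem_box_cart abs_less_iff minus_less_iff)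
        qed
        then show "indicator ?C (h + x) * ennreal \<bar>a (h + x) - a x\<bar> / ?v \<le>
            w h * ennreal \<bar>a (x + h) - a x\<bar>"
          by (auto simp: w_def indicator_def add.commute ennreal_divide_times)
      qed
      finally show ?thesis .
    qed
    show "L1_norm (\<lambda>x. a (x + h) - a x) \<le> c" if "w h \<noteq> 0" for h
    proof (rule c)
      have "h \<in> ?B" using that by (auto simp: w_def indicator_def split: if_splits)
      then show "\<bar>h $ i\<bar> < \<epsilon>" for i
        by (auto simp: mem_box_cart abs_less_iff minus_less_iff)
    qed
  qed measurable
  also have "(\<integral>\<^sup>+h. w h \<partial>lborel) = 2 ^ CARD('n)"
  proof -
    have side: "((\<chi> i. \<epsilon>) - (\<chi> i. - \<epsilon>) :: real ^ 'n) \<bullet> b = 2 * \<epsilon>" if "b \<in> Basis" for b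
      using that by (auto simp: Basis_vec_def inner_axis)
    then have "(\<chi> i. - \<epsilon> :: real ^ 'n) \<bullet> b \<le> (\<chi> i. \<epsilon>) \<bullet> b" if "b \<in> Basis" for b
      using that assms(1) by (auto simp: Basis_vec_def inner_axis)
    then have "emeasure lborel ?B = ennreal (\<Prod>b\<in>(Basis :: (real ^ 'n) set). 2 * \<epsilon>)"
      by (subst emeasure_lborel_box) (auto simp: side intro!: arg_cong[where f = ennreal] prod.cong)
    also have "\<dots> = 2 ^ CARD('n) * ?v"
      using assms(1) by (simp add: power_mult_distrib ennreal_mult) (simp flip: ennreal_power)
    finally have "(\<integral>\<^sup>+h. w h \<partial>lborel) = 2 ^ CARD('n) * ?v / ?v"
      by (simp add: w_def nn_integral_divide)
    also have "\<dots> = 2 ^ CARD('n)"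
      using assms(1) by (simp add: ennreal_mult_divide_eq)
    finally show ?thesis .
  qed
  finally show ?thesis .
qed

subsection \<open>Convolution and its discretization\<close>

lemma nn_integral_lborel_reflect:
  fixes f :: "real ^ 'n \<Rightarrow> ennreal"
  assumes [measurable]: "f \<in> borel_measurable borel"
  shows "(\<integral>\<^sup>+y. f (x - y) \<partial>lborel) = (\<integral>\<^sup>+y. f y \<partial>lborel)"
proof -
  have "distr lborel borel (\<lambda>y. x - y) = (lborel :: (real ^ 'n) measure)"
    using lborel_affine[of "-1" x] by (simp add: density_1)
  then have "(\<integral>\<^sup>+y. f y \<partial>lborel) = (\<integral>\<^sup>+y. f y \<partial>distr lborel borel (\<lambda>y. x - y))"
    by simp
  also have "\<dots> = (\<integral>\<^sup>+y. f (x - y) \<partial>lborel)"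
    by (rule nn_integral_distr) auto
  finally show ?thesis by simp
qed

lemma L1_reflect:
  assumes "f \<in> L1"
  shows "(\<lambda>y. f (x - y)) \<in> L1"
proof -
  have [measurable]: "f \<in> borel_measurable borel" by (rule L1_borel_measurable) fact
  have "L1_norm (\<lambda>y. f (x - y)) = L1_norm f"
    unfolding L1_norm_def by (rule nn_integral_lborel_reflect[where f = "\<lambda>y. ennreal \<bar>f y\<bar>"]) auto
  then show ?thesis using assms by (simp add: L1_iff_norm_finite)
qed

lemma L1_eq_reflect:
  assumes [measurable]: "f \<in> borel_measurable borel" "g \<in> borel_measurable borel"
    and "f \<doteq> g"
  shows "(\<lambda>y. f (x - y)) \<doteq> (\<lambda>y. g (x - y))"
proof -
  have "L1_norm (\<lambda>y. f (x - y) - g (x - y)) = L1_norm (\<lambda>y. f y - g y)"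
    unfolding L1_norm_def
    by (rule nn_integral_lborel_reflect[where f = "\<lambda>y. ennreal \<bar>f y - g y\<bar>"]) auto
  also have "\<dots> = 0" using assms by (simp add: L1_norm_diff_eq_0_iff)
  finally show ?thesis by (simp add: L1_norm_diff_eq_0_iff)
qed

lemma L1_eq_translate:
  assumes [measurable]: "f \<in> borel_measurable borel" "g \<in> borel_measurable borel"
    and "f \<doteq> g"
  shows "(\<lambda>y. f (y + h)) \<doteq> (\<lambda>y. g (y + h))"
proof -
  have "L1_norm (\<lambda>y. f (y + h) - g (y + h)) = L1_norm (\<lambda>y. f y - g y)"
    by (rule L1_norm_translate[where f = "\<lambda>y. f y - g y"]) auto
  also have "\<dots> = 0" using assms by (simp add: L1_norm_diff_eq_0_iff)
  finally show ?thesis by (simp add: L1_norm_diff_eq_0_iff)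
qed

text \<open>Integrability is implicit in the normalisation: the integral of a non-integrable
  function would be 0 and not 1.\<close>

lemma kernel_L1:
  assumes "\<kappa> \<in> kernels"
  shows "\<kappa> \<in> L1"
proof -
  have "(\<integral>x. \<kappa> x \<partial>lborel) = 1" using assms by (simp add: kernels_def)
  then show ?thesis unfolding L1_def using not_integrable_integral_eq by fastforce
qed

lemma L1_norm_kernel:
  assumes "\<kappa> \<in> kernels"
  shows "L1_norm \<kappa> = 1"
proof -
  have "L1_norm \<kappa> = (\<integral>\<^sup>+x. ennreal (\<kappa> x) \<partial>lborel)"
    unfolding L1_norm_def using assms by (intro nn_integral_cong_AE) (auto simp: kernels_def)
  also have "\<dots> = ennreal (\<integral>x. \<kappa> x \<partial>lborel)"
    using kernel_L1[OF assms] assms by (intro nn_integral_eq_integral) (auto simp: kernels_def L1_def)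
  finally show ?thesis using assms by (simp add: kernels_def)
qed

text \<open>
  Taking \<open>T\<close> to be the identity gives \<open>conv\<close>, and rounding to the grid gives \<open>discrete_conv\<close>, so that
  comparing the two amounts to perturbing the translations by at most the grid size.
\<close>
definition smear :: "(real ^ 'n \<Rightarrow> real ^ 'n) \<Rightarrow> (real ^ 'n \<Rightarrow> real) \<Rightarrow> (real ^ 'n \<Rightarrow> real) \<Rightarrow>
    real ^ 'n \<Rightarrow> real" where
  "smear T \<kappa> a x = (\<integral>y. \<kappa> y * a (x - T y) \<partial>lborel)"

lemma conv_eq_smear: "conv \<kappa> a = smear (\<lambda>y. y) \<kappa> a"
  by (simp add: fun_eq_iff conv_def smear_def)

lemma smear_measurable:
  assumes [measurable]: "T \<in> borel \<rightarrow>\<^sub>M borel" "\<kappa> \<in> borel_measurable borel" "a \<in> borel_measurable borel"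
  shows "smear T \<kappa> a \<in> borel_measurable borel"
  unfolding smear_def[abs_def] by measurable

text \<open>The smeared function averages translates of \<open>a\<close> against a weight of total
  mass 1, and each translate has the norm of \<open>a\<close>.\<close>

lemma L1_norm_smear_le:
  assumes \<kappa>: "\<kappa> \<in> kernels"
    and [measurable]: "T \<in> borel \<rightarrow>\<^sub>M borel" "a \<in> borel_measurable borel"
  shows "L1_norm (smear T \<kappa> a) \<le> L1_norm a"
proof -
  have [measurable]: "\<kappa> \<in> borel_measurable borel" using \<kappa> by (simp add: kernels_def)
  have "L1_norm (smear T \<kappa> a) \<le> (\<integral>\<^sup>+y. ennreal \<bar>\<kappa> y\<bar> \<partial>lborel) * L1_norm a"
  proof (rule L1_norm_Minkowski[where F = "\<lambda>y x. a (x - T y)"])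
    show "ennreal \<bar>smear T \<kappa> a x\<bar> \<le> (\<integral>\<^sup>+y. ennreal \<bar>\<kappa> y\<bar> * ennreal \<bar>a (x - T y)\<bar> \<partial>lborel)" for x
      using abs_integral_le_nn_integral[of lborel "\<lambda>y. \<kappa> y * a (x - T y)"]
      by (simp add: smear_def abs_mult ennreal_mult)
    show "L1_norm (\<lambda>x. a (x - T y)) \<le> L1_norm a" for y
      using L1_norm_translate[of a "- T y"] by simp
  qed measurable
  then show ?thesis using L1_norm_kernel[OF \<kappa>] by (simp add: L1_norm_def)
qed

lemma smear_L1:
  assumes "\<kappa> \<in> kernels" "T \<in> borel \<rightarrow>\<^sub>M borel" "a \<in> L1"
  shows "smear T \<kappa> a \<in> L1"
  using assms L1_norm_smear_le[of \<kappa> T a] smear_measurable[of T \<kappa> a]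
  by (auto simp: L1_iff_norm_finite kernels_def intro: order_le_less_trans)

text \<open>Two averages against the same probability weight differ by at most the worst distance
  between the averaged translates. Integrability is asked at every \<open>x\<close> so that the two
  integrals can be merged pointwise.\<close>

lemma L1_norm_smear_diff_le:
  assumes \<kappa>: "\<kappa> \<in> kernels"
    and [measurable]: "T \<in> borel \<rightarrow>\<^sub>M borel" "S \<in> borel \<rightarrow>\<^sub>M borel"
      "a \<in> borel_measurable borel" "b \<in> borel_measurable borel"
    and T: "\<And>x. integrable lborel (\<lambda>y. \<kappa> y * a (x - T y))"
    and S: "\<And>x. integrable lborel (\<lambda>y. \<kappa> y * b (x - S y))"
    and c: "\<And>y. L1_norm (\<lambda>x. a (x - T y) - b (x - S y)) \<le> c"
  shows "L1_norm (\<lambda>x. smear T \<kappa> a x - smear S \<kappa> b x) \<le> c"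
proof -
  have [measurable]: "\<kappa> \<in> borel_measurable borel" using \<kappa> by (simp add: kernels_def)
  have "L1_norm (\<lambda>x. smear T \<kappa> a x - smear S \<kappa> b x) \<le> (\<integral>\<^sup>+y. ennreal \<bar>\<kappa> y\<bar> \<partial>lborel) * c"
  proof (rule L1_norm_Minkowski[where F = "\<lambda>y x. a (x - T y) - b (x - S y)"])
    fix x
    have "smear T \<kappa> a x - smear S \<kappa> b x = (\<integral>y. \<kappa> y * (a (x - T y) - b (x - S y)) \<partial>lborel)"
      unfolding smear_def by (simp add: Bochner_Integration.integral_diff[OF T S, symmetric] right_diff_distrib)
    then show "ennreal \<bar>smear T \<kappa> a x - smear S \<kappa> b x\<bar> \<le>
        (\<integral>\<^sup>+y. ennreal \<bar>\<kappa> y\<bar> * ennreal \<bar>a (x - T y) - b (x - S y)\<bar> \<partial>lborel)"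
      using abs_integral_le_nn_integral[of lborel "\<lambda>y. \<kappa> y * (a (x - T y) - b (x - S y))"]
      by (simp add: abs_mult ennreal_mult)
  qed (use c in measurable)
  then show ?thesis using L1_norm_kernel[OF \<kappa>] by (simp add: L1_norm_def)
qed

text \<open>Reflection and translation preserve null sets, so for every \<open>x\<close> the
  integrands agree almost everywhere. The convolutions hence agree everywhere, which lets conditions
  on \<open>conv\<close> pass between representatives.\<close>

lemma conv_cong_AE:
  assumes [measurable]: "\<kappa> \<in> borel_measurable borel" and "f \<in> L1" "g \<in> L1" "f \<doteq> g"
  shows "conv \<kappa> f = conv \<kappa> g"
proof
  fix x
  have [measurable]: "f \<in> borel_measurable borel" "g \<in> borel_measurable borel"
    using assms by (auto intro: L1_borel_measurable)
  have ae: "AE y in lborel. f (x - y) = g (x - y)"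
    using L1_eq_reflect[of f g x] assms by (simp add: L1_eq_def)
  then show "conv \<kappa> f x = conv \<kappa> g x"
    unfolding conv_def by (intro integral_cong_AE) auto
qed

lemma conv_shift: "conv \<kappa> (shift v a) = shift v (conv \<kappa> a)"
  by (simp add: fun_eq_iff conv_def shift_def algebra_simps)

text \<open>Boundedness of the kernel yields integrability at every \<open>x\<close>, where Fubini
  alone would yield it only at almost every \<open>x\<close>.\<close>

lemma integrable_kernel_mult:
  assumes \<kappa>: "\<kappa> \<in> kernels" and "a \<in> L1"
  shows "integrable lborel (\<lambda>y. \<kappa> y * a (x - y))"
proof -
  have [measurable]: "\<kappa> \<in> borel_measurable borel" "a \<in> borel_measurable borel"
    using assms by (auto simp: kernels_def intro: L1_borel_measurable)
  obtain B where B: "AE y in lborel. \<kappa> y \<le> B" "AE y in lborel. 0 \<le> \<kappa> y"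
    using \<kappa> by (auto simp: kernels_def)
  show ?thesis
  proof (rule Bochner_Integration.integrable_bound)
    show "integrable lborel (\<lambda>y. B * a (x - y))"
      using L1_reflect[OF assms(2)] by (simp add: L1_def)
    show "AE y in lborel. norm (\<kappa> y * a (x - y)) \<le> norm (B * a (x - y))"
      using B by eventually_elim (auto simp: abs_mult intro!: mult_right_mono)
  qed measurable
qed

lemma finite_grid_index_image:
  fixes K :: "(real ^ 'n) set"
  assumes "bounded K" "\<epsilon> > 0"
  shows "finite (grid_index \<epsilon> ` K)"
proof -
  obtain r where r: "\<And>x. x \<in> K \<Longrightarrow> norm x \<le> r" using assms(1) by (auto simp: bounded_iff)
  let ?S = "{\<lfloor>- r / \<epsilon> + 1 / 2\<rfloor>..\<lfloor>r / \<epsilon> + 1 / 2\<rfloor>}"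
  have "grid_index \<epsilon> ` K \<subseteq> vec_lambda ` (UNIV \<rightarrow>\<^sub>E ?S)"
  proof
    fix z assume "z \<in> grid_index \<epsilon> ` K"
    then obtain x where x: "x \<in> K" "z = grid_index \<epsilon> x" by blast
    have "\<bar>x $ i\<bar> \<le> r" for i
      using r[OF x(1)] component_le_norm_cart[of x i] by linarith
    then have "- r \<le> x $ i" "x $ i \<le> r" for i
      by (simp_all add: abs_le_iff minus_le_iff)
    then have "- r / \<epsilon> \<le> x $ i / \<epsilon>" "x $ i / \<epsilon> \<le> r / \<epsilon>" for i
      using assms(2) by (intro divide_right_mono; simp)+
    then have "vec_nth z \<in> UNIV \<rightarrow>\<^sub>E ?S"
      by (auto simp: x(2) grid_index_def intro!: floor_mono)
    then show "z \<in> vec_lambda ` (UNIV \<rightarrow>\<^sub>E ?S)"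
      by (metis image_eqI vec_nth_inverse)
  qed
  then show ?thesis by (rule finite_subset) (intro finite_imageI finite_PiE, auto)
qed

text \<open>Only the finitely many cubes that meet the compact support carry mass, so the infinite
  sum is finite and can be moved inside the integral. For fixed \<open>x\<close> only finitely many
  values of \<open>b\<close> enter, which gives integrability as well.\<close>

lemma discrete_conv_smear:
  fixes \<kappa> b :: "real ^ 'n \<Rightarrow> real"
  assumes \<kappa>: "\<kappa> \<in> kernels" and "\<epsilon> > 0" and [measurable]: "b \<in> borel_measurable borel"
  shows "discrete_conv \<epsilon> \<kappa> b x = smear (grid_round \<epsilon>) \<kappa> b x" (is ?eq)
    and "integrable lborel (\<lambda>y. \<kappa> y * b (x - grid_round \<epsilon> y))" (is ?int)
proof -
  obtain K where K: "compact K" "AE y in lborel. y \<notin> K \<longrightarrow> \<kappa> y = 0"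
    using \<kappa> by (auto simp: kernels_def)
  have [measurable]: "\<kappa> \<in> borel_measurable borel" using \<kappa> by (auto simp: kernels_def)
  have [measurable]: "grid_round \<epsilon> \<in> (borel :: (real ^ 'n) measure) \<rightarrow>\<^sub>M borel"
    by (rule grid_round_measurable) fact
  define Z where "Z = grid_index \<epsilon> ` K"
  have fin: "finite Z"
    unfolding Z_def by (intro finite_grid_index_image compact_imp_bounded K assms)
  let ?b = "\<lambda>z. b (x - \<epsilon> *\<^sub>R lattice_point z)"
  let ?s = "\<lambda>y. \<Sum>z\<in>Z. indicator (cube \<epsilon> z) y * \<kappa> y * ?b z"
  have int: "integrable lborel (\<lambda>y. indicator (cube \<epsilon> z) y * \<kappa> y)" for z
    using L1_set_integrable_cube[OF kernel_L1[OF \<kappa>]] by (simp add: set_integrable_def)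
  have ae: "AE y in lborel. ?s y = \<kappa> y * b (x - grid_round \<epsilon> y)"
    using K(2)
  proof eventually_elim
    case (elim y)
    \<comment> \<open>The cubes partition the space, so only the one containing \<open>y\<close>
      contributes. If its index is outside \<open>Z\<close>, then \<open>y\<close> is outside
      \<open>K\<close> and the kernel vanishes there.\<close>
    have "?s y = (\<Sum>z\<in>Z. if z = grid_index \<epsilon> y then \<kappa> y * b (x - grid_round \<epsilon> y) else 0)"
      by (intro sum.cong) (auto simp: indicator_def mem_cube_iff assms grid_round_def)
    also have "\<dots> = \<kappa> y * b (x - grid_round \<epsilon> y)"
      using elim fin by (auto simp: Z_def)
    finally show ?case .
  qed
  have int_s: "integrable lborel ?s"
    by (intro Bochner_Integration.integrable_sum integrable_mult_left int)
  show ?int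
    using ae by (intro integrable_cong_AE_imp[OF int_s]) (auto simp: eq_commute)
  have zero: "(LINT y:cube \<epsilon> z|lborel. \<kappa> y) = 0" if "z \<notin> Z" for z
  proof -
    have "AE y in lborel. indicator (cube \<epsilon> z) y *\<^sub>R \<kappa> y = 0"
      using K(2) by eventually_elim (use that in \<open>auto simp: Z_def indicator_def mem_cube_iff assms\<close>)
    then show ?thesis
      unfolding set_lebesgue_integral_def by (rule integral_eq_zero_AE)
  qed
  have "discrete_conv \<epsilon> \<kappa> b x = (\<Sum>\<^sub>\<infinity>z\<in>Z. (LINT y:cube \<epsilon> z|lborel. \<kappa> y) * ?b z)"
    unfolding discrete_conv_def by (intro infsum_cong_neutral) (auto simp: zero)
  also have "\<dots> = (\<Sum>z\<in>Z. (LINT y:cube \<epsilon> z|lborel. \<kappa> y) * ?b z)"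
    using fin by simp
  also have "\<dots> = (\<integral>y. ?s y \<partial>lborel)"
    using int by (simp add: set_lebesgue_integral_def)
  also have "\<dots> = smear (grid_round \<epsilon>) \<kappa> b x"
    unfolding smear_def using ae by (intro integral_cong_AE) auto
  finally show ?eq .
qed

subsection \<open>Convergence and evolution\<close>

lemma indicator_Icc_diff_le:
  fixes s t c d \<delta> :: real
  assumes "\<delta> > 0"
  shows "\<bar>indicator {c..d} s - indicator {c..d} t :: real\<bar> \<le>
    indicator {r. \<bar>r - c\<bar> \<le> \<delta> \<or> \<bar>r - d\<bar> \<le> \<delta>} t + \<bar>s - t\<bar> / \<delta>"
\<comment> \<open>If \<open>s\<close> and \<open>t\<close> are closer than \<open>\<delta>\<close>,
  the indicators can differ only when \<open>t\<close> is within \<open>\<delta>\<close> of an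
  endpoint. Otherwise the quotient is at least 1 and pays for any difference, as in Markov's
  inequality.\<close>
proof (cases "\<bar>s - t\<bar> < \<delta>")
  case True
  then have "\<bar>indicator {c..d} s - indicator {c..d} t :: real\<bar> \<le>
      indicator {r. \<bar>r - c\<bar> \<le> \<delta> \<or> \<bar>r - d\<bar> \<le> \<delta>} t"
    by (auto simp: indicator_def)
  moreover have "0 \<le> \<bar>s - t\<bar> / \<delta>" using assms by simp
  ultimately show ?thesis by linarith
next
  case False
  then have "1 \<le> \<bar>s - t\<bar> / \<delta>" using assms by simp
  then show ?thesis by (auto simp: indicator_def)
qed

lemma L1_norm_indicator_Icc_tendsto:
  fixes v :: "nat \<Rightarrow> real ^ 'n \<Rightarrow> real"
  assumes c: "0 < c" "c \<le> d" and v: "\<And>n. v n \<in> borel_measurable borel" and u: "u \<in> L1"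
    and lim: "(\<lambda>n. L1_norm (\<lambda>x. v n x - u x)) \<longlonglongrightarrow> 0"
    and endpoints: "AE x in lborel. u x \<noteq> c \<and> u x \<noteq> d"
  shows "(\<lambda>n. L1_norm (\<lambda>x. indicator {c..d} (v n x) - indicator {c..d} (u x))) \<longlonglongrightarrow> 0"
proof (rule tendsto_zero_ennreal)
  fix r :: real assume "0 < r"
  have [measurable]: "u \<in> borel_measurable borel" by (rule L1_borel_measurable[OF u])
  note v[measurable]
  \<comment> \<open>The widths tend to 0 and never exceed \<open>c / 2\<close>. Since both endpoints
    are at least \<open>c\<close>, the function \<open>u\<close> stays at least \<open>c / 2\<close>
    near either of them.\<close>
  define \<delta> where "\<delta> k = c / 2 / real (Suc k)" for k
  have \<delta>: "0 < \<delta> k" "\<delta> k \<le> c / 2" for k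
    using c by (auto simp: \<delta>_def field_simps)
  define N where "N k = {x. \<bar>u x - c\<bar> \<le> \<delta> k \<or> \<bar>u x - d\<bar> \<le> \<delta> k}" for k
  have N[measurable]: "N k \<in> sets borel" for k unfolding N_def by measurable
  have \<delta>_lim: "\<delta> \<longlonglongrightarrow> 0"
    unfolding \<delta>_def by (rule LIMSEQ_Suc) (rule lim_const_over_n)
  have Int: "(\<Inter>k. N k) \<subseteq> {x. u x = c \<or> u x = d}"
  proof (rule subsetI, rule ccontr)
    fix x assume x: "x \<in> (\<Inter>k. N k)" and "x \<notin> {x. u x = c \<or> u x = d}"
    then have "0 < min \<bar>u x - c\<bar> \<bar>u x - d\<bar>" by auto
    then have "\<forall>\<^sub>F k in sequentially. \<delta> k < min \<bar>u x - c\<bar> \<bar>u x - d\<bar>"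
      by (rule order_tendstoD(2)[OF \<delta>_lim])
    then obtain k where "\<delta> k < min \<bar>u x - c\<bar> \<bar>u x - d\<bar>"
      using eventually_happens'[OF sequentially_bot] by blast
    moreover have "x \<in> N k" using x by blast
    ultimately show False by (auto simp: N_def)
  qed
  \<comment> \<open>Chebyshev's inequality at level \<open>c / 2\<close>. The resulting finiteness
    is what continuity from above requires for the decreasing sets \<open>N k\<close>; positivity of
    the lower endpoint enters here.\<close>
  have "emeasure lborel (N 0) \<le> (\<integral>\<^sup>+x. ennreal (2 / c) * ennreal \<bar>u x\<bar> \<partial>lborel)"
  proof -
    have "emeasure lborel (N 0) = (\<integral>\<^sup>+x. indicator (N 0) x \<partial>lborel)" by simp
    also have "\<dots> \<le> (\<integral>\<^sup>+x. ennreal (2 / c) * ennreal \<bar>u x\<bar> \<partial>lborel)"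
    proof (rule nn_integral_mono)
      fix x
      have "1 \<le> 2 / c * \<bar>u x\<bar>" if "x \<in> N 0"
      proof -
        have "c / 2 \<le> \<bar>u x\<bar>"
          using that \<delta>(2)[of 0] c unfolding N_def mem_Collect_eq by linarith
        then show ?thesis using c by (simp add: field_simps)
      qed
      then show "indicator (N 0) x \<le> ennreal (2 / c) * ennreal \<bar>u x\<bar>"
        using c by (auto simp: indicator_def simp flip: ennreal_mult' intro: ennreal_leI[of 1, simplified])
    qed
    finally show ?thesis .
  qed
  also have "\<dots> = ennreal (2 / c) * L1_norm u"
    unfolding L1_norm_def by (rule nn_integral_cmult) simp
  also have "\<dots> < \<infinity>"
    using u by (simp add: L1_iff_norm_finite ennreal_mult_less_top)
  finally have fin0: "emeasure lborel (N 0) < \<infinity>" .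
  have mono: "\<delta> m \<le> \<delta> k" if "k \<le> m" for k m
    unfolding \<delta>_def using that c by (intro divide_left_mono) auto
  then have decr: "decseq N"
    by (fastforce simp: decseq_def N_def intro: order_trans)
  have fin: "emeasure lborel (N k) \<noteq> \<infinity>" for k
    using emeasure_mono[OF decseqD[OF decr, of 0 k], of lborel] fin0 by (auto simp: top_unique)
  have "(\<lambda>k. emeasure lborel (N k)) \<longlonglongrightarrow> emeasure lborel (\<Inter>k. N k)"
    using decr fin by (intro Lim_emeasure_decseq) auto
  moreover have "emeasure lborel (\<Inter>k. N k) = 0"
  proof -
    have "AE x in lborel. x \<notin> (\<Inter>k. N k)"
      using endpoints by eventually_elim (use Int in blast)
    from emeasure_eq_0_AE[OF this] show ?thesis
      by (simp only: space_lborel space_borel UNIV_I simp_thms Collect_mem_eq)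
  qed
  ultimately have "(\<lambda>k. emeasure lborel (N k)) \<longlonglongrightarrow> 0" by simp
  then have "\<forall>\<^sub>F k in sequentially. emeasure lborel (N k) < ennreal (r / 2)"
    using \<open>0 < r\<close> by (intro order_tendstoD(2)) auto
  then obtain k where k: "emeasure lborel (N k) < ennreal (r / 2)"
    using eventually_happens'[OF sequentially_bot] by blast
  \<comment> \<open>The index \<open>k\<close> is fixed first, so \<open>1 / \<delta> k\<close> is a
    constant and the second summand tends to 0 with \<open>n\<close>.\<close>
  have bound: "L1_norm (\<lambda>x. indicator {c..d} (v n x) - indicator {c..d} (u x)) \<le>
      emeasure lborel (N k) + ennreal (1 / \<delta> k) * L1_norm (\<lambda>x. v n x - u x)" for n
  proof -
    have "L1_norm (\<lambda>x. indicator {c..d} (v n x) - indicator {c..d} (u x)) \<le>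
        (\<integral>\<^sup>+x. indicator (N k) x + ennreal (1 / \<delta> k) * ennreal \<bar>v n x - u x\<bar> \<partial>lborel)"
      unfolding L1_norm_def
    proof (rule nn_integral_mono)
      fix x
      have "ennreal \<bar>indicator {c..d} (v n x) - indicator {c..d} (u x)\<bar> \<le>
          ennreal (indicator (N k) x + \<bar>v n x - u x\<bar> / \<delta> k)"
        using indicator_Icc_diff_le[OF \<delta>(1), of c d "v n x" "u x" k]
        by (intro ennreal_leI) (simp add: N_def indicator_def)
      also have "\<dots> = indicator (N k) x + ennreal (1 / \<delta> k) * ennreal \<bar>v n x - u x\<bar>"
        using \<delta>(1)[of k] by (simp add: ennreal_plus ennreal_indicator flip: ennreal_mult')
      finally show "ennreal \<bar>indicator {c..d} (v n x) - indicator {c..d} (u x)\<bar> \<le>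
          indicator (N k) x + ennreal (1 / \<delta> k) * ennreal \<bar>v n x - u x\<bar>" .
    qed
    also have "\<dots> = emeasure lborel (N k) + ennreal (1 / \<delta> k) * L1_norm (\<lambda>x. v n x - u x)"
      unfolding L1_norm_def by (simp add: nn_integral_add nn_integral_cmult)
    finally show ?thesis .
  qed
  have "(\<lambda>n. ennreal (1 / \<delta> k) * L1_norm (\<lambda>x. v n x - u x)) \<longlonglongrightarrow> ennreal (1 / \<delta> k) * 0"
    by (intro ennreal_tendsto_cmult lim) simp
  then have "\<forall>\<^sub>F n in sequentially. ennreal (1 / \<delta> k) * L1_norm (\<lambda>x. v n x - u x) < ennreal (r / 2)"
    using \<open>0 < r\<close> by (intro order_tendstoD(2)) auto
  then show "\<forall>\<^sub>F n in sequentially.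
      L1_norm (\<lambda>x. indicator {c..d} (v n x) - indicator {c..d} (u x)) < ennreal r"
  proof eventually_elim
    case (elim n)
    have "L1_norm (\<lambda>x. indicator {c..d} (v n x) - indicator {c..d} (u x)) < ennreal (r / 2) + ennreal (r / 2)"
      using bound[of n] add_strict_mono[OF k elim] by (rule order_le_less_trans)
    then show ?case using \<open>0 < r\<close> by (simp flip: ennreal_plus)
  qed
qed

section \<open>The life rule and well-definedness of the automata on \<open>L1\<close>\<close>

lemma life_rule_L1:
  assumes \<theta>: "\<theta> \<in> Theta" and b: "b \<in> L1" and u: "u \<in> L1"
  shows "life_rule \<theta> b u \<in> L1"
proof -
  obtain s0 b0 b1 s1 where \<theta>_eq: "\<theta> = (s0, b0, b1, s1)" by (cases \<theta>)
  have pos: "0 < b0" using \<theta> by (auto simp: Theta_def \<theta>_eq)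
  have [measurable]: "b \<in> borel_measurable borel" "u \<in> borel_measurable borel"
    using b u by (auto intro: L1_borel_measurable)
  have "integrable lborel (\<lambda>x. life_rule \<theta> b u x)"
  proof (rule Bochner_Integration.integrable_bound)
    show "integrable lborel (\<lambda>x. 2 * \<bar>b x\<bar> + \<bar>u x\<bar> / b0)"
      using b u by (simp add: L1_def)
    show "(\<lambda>x. life_rule \<theta> b u x) \<in> borel_measurable lborel"
      unfolding \<theta>_eq life_rule.simps by measurable
    show "AE x in lborel. norm (life_rule \<theta> b u x) \<le> norm (2 * \<bar>b x\<bar> + \<bar>u x\<bar> / b0)"
    proof (rule AE_I2)
      fix x
      \<comment> \<open>Birth requires \<open>u x\<close> to be at least \<open>b0\<close>, which is
        positive; so the part of the birth term not multiplied by \<open>b\<close> is controlled by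
        \<open>u\<close>, and integrable.\<close>
      have "(indicator {b0..b1} (u x) :: real) \<le> \<bar>u x\<bar> / b0"
        using pos by (auto simp: indicator_def field_simps)
      moreover have "0 \<le> \<bar>u x\<bar> / b0" using pos by simp
      ultimately show "norm (life_rule \<theta> b u x) \<le> norm (2 * \<bar>b x\<bar> + \<bar>u x\<bar> / b0)"
        by (auto simp: \<theta>_eq indicator_def)
    qed
  qed
  then show ?thesis by (simp add: L1_def)
qed

text \<open>Write the difference as \<open>b - a\<close> times the difference of the two indicators
  at \<open>v\<close>, plus \<open>a\<close> times the change of the survival indicator, plus
  \<open>1 - a\<close> times the change of the birth indicator. All coefficients of the three
  changes have modulus at most 1.\<close>

lemma life_rule_diff_le:
  assumes "a x \<in> {0, 1}"
  shows "\<bar>life_rule (s0, b0, b1, s1) b v x - life_rule (s0, b0, b1, s1) a u x\<bar> \<le>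
    \<bar>b x - a x\<bar> + (\<bar>indicator {s0..s1} (v x) - indicator {s0..s1} (u x)\<bar> +
      \<bar>indicator {b0..b1} (v x) - indicator {b0..b1} (u x)\<bar>)"
  using assms by (auto simp: indicator_def)

lemma L1_norm_life_rule_diff_le:
  assumes [measurable]: "a \<in> borel_measurable borel" "b \<in> borel_measurable borel"
      "u \<in> borel_measurable borel" "v \<in> borel_measurable borel"
    and a: "AE x in lborel. a x \<in> {0, 1}"
  shows "L1_norm (\<lambda>x. life_rule (s0, b0, b1, s1) b v x - life_rule (s0, b0, b1, s1) a u x) \<le>
    L1_norm (\<lambda>x. b x - a x) +
    (L1_norm (\<lambda>x. indicator {s0..s1} (v x) - indicator {s0..s1} (u x)) +
     L1_norm (\<lambda>x. indicator {b0..b1} (v x) - indicator {b0..b1} (u x)))"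
proof -
  have "L1_norm (\<lambda>x. life_rule (s0, b0, b1, s1) b v x - life_rule (s0, b0, b1, s1) a u x) \<le>
    (\<integral>\<^sup>+x. ennreal \<bar>b x - a x\<bar> + (ennreal \<bar>indicator {s0..s1} (v x) - indicator {s0..s1} (u x)\<bar> +
      ennreal \<bar>indicator {b0..b1} (v x) - indicator {b0..b1} (u x)\<bar>) \<partial>lborel)"
    unfolding L1_norm_def
  proof (rule nn_integral_mono_AE, use a in eventually_elim)
    case (elim x)
    from ennreal_leI[OF life_rule_diff_le[of a x s0 b0 b1 s1 b v u, OF elim]]
    show ?case by (simp add: ennreal_plus del: life_rule.simps)
  qed
  also have "\<dots> = L1_norm (\<lambda>x. b x - a x) +
    (L1_norm (\<lambda>x. indicator {s0..s1} (v x) - indicator {s0..s1} (u x)) +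
     L1_norm (\<lambda>x. indicator {b0..b1} (v x) - indicator {b0..b1} (u x)))"
    unfolding L1_norm_def by (simp add: nn_integral_add)
  finally show ?thesis .
qed

lemma discrete_conv_L1:
  assumes "\<kappa> \<in> kernels" "\<epsilon> > 0" "b \<in> L1"
  shows "discrete_conv \<epsilon> \<kappa> b \<in> L1"
proof -
  have "discrete_conv \<epsilon> \<kappa> b = smear (grid_round \<epsilon>) \<kappa> b"
    using assms by (intro ext discrete_conv_smear L1_borel_measurable)
  then show ?thesis using assms by (simp add: smear_L1 grid_round_measurable)
qed

lemma conv_L1: "\<kappa> \<in> kernels \<Longrightarrow> a \<in> L1 \<Longrightarrow> conv \<kappa> a \<in> L1"
  by (simp add: conv_eq_smear smear_L1)

lemma L1_map_RealLife:
  fixes \<kappa> :: "real ^ 'n \<Rightarrow> real"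
  assumes "\<theta> \<in> Theta" "\<kappa> \<in> kernels"
  shows "L1_map (RealLife \<theta> \<kappa>)"
  unfolding L1_map_def
proof (intro conjI ballI impI)
  fix f g :: "real ^ 'n \<Rightarrow> real" assume f: "f \<in> L1"
  then show "RealLife \<theta> \<kappa> f \<in> L1"
    unfolding RealLife_def by (intro life_rule_L1 conv_L1 assms)
  assume g: "g \<in> L1" "f \<doteq> g"
  have "conv \<kappa> f = conv \<kappa> g"
    using assms f g by (intro conv_cong_AE) (auto simp: kernels_def)
  then show "RealLife \<theta> \<kappa> f \<doteq> RealLife \<theta> \<kappa> g"
    using g(2) unfolding RealLife_def L1_eq_def
    by (cases \<theta>) (auto elim!: eventually_mono)
qed

lemma L1_map_discrete_RealLife:
  fixes \<kappa> :: "real ^ 'n \<Rightarrow> real"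
  assumes "\<theta> \<in> Theta" "\<kappa> \<in> kernels" "\<epsilon> > 0"
  shows "L1_map (discrete_RealLife \<theta> \<kappa> \<epsilon>)"
  unfolding L1_map_def
proof (intro conjI ballI impI)
  fix f g :: "real ^ 'n \<Rightarrow> real" assume f: "f \<in> L1"
  then show "discrete_RealLife \<theta> \<kappa> \<epsilon> f \<in> L1"
    unfolding discrete_RealLife_def Let_def
    by (intro life_rule_L1 discrete_conv_L1 cube_exp_L1 assms)
  assume "g \<in> L1" "f \<doteq> g"
  then have "cube_exp \<epsilon> f = cube_exp \<epsilon> g"
    using assms f by (intro cube_exp_cong_AE)
  then show "discrete_RealLife \<theta> \<kappa> \<epsilon> f \<doteq> discrete_RealLife \<theta> \<kappa> \<epsilon> g"
    by (simp add: discrete_RealLife_def L1_eq_def)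
qed

section \<open>Convergence of shifts, cell averages and discrete convolutions\<close>

lemma shift_tendsto:
  assumes "a \<in> L1" and an: "\<And>n. an n \<in> L1"
    and lim: "(\<lambda>n. L1_norm (\<lambda>x. an n x - a x)) \<longlonglongrightarrow> 0" and v: "vn \<longlonglongrightarrow> v"
  shows "(\<lambda>n. L1_norm (\<lambda>x. shift (vn n) (an n) x - shift v a x)) \<longlonglongrightarrow> 0"
proof (rule tendsto_sandwich[OF _ _ tendsto_const])
  have [measurable]: "a \<in> borel_measurable borel" "an n \<in> borel_measurable borel" for n
    using assms by (auto intro: L1_borel_measurable)
  \<comment> \<open>The velocities may equal their limit, so the composition below relies on
    continuity of translation being stated with \<open>nhds 0\<close> and not the punctured
    filter.\<close>
  have "(\<lambda>n. vn n - v) \<longlonglongrightarrow> 0" using v by (simp add: LIM_zero)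
  then have "(\<lambda>n. L1_norm (\<lambda>x. a (x + (vn n - v)) - a x)) \<longlonglongrightarrow> 0"
    using L1_shift_continuous[OF assms(1)] unfolding L1_shift_continuous_def
    by (rule filterlim_compose[rotated])
  from tendsto_add[OF lim this]
  show "(\<lambda>n. L1_norm (\<lambda>x. an n x - a x) + L1_norm (\<lambda>x. a (x + (vn n - v)) - a x)) \<longlonglongrightarrow> 0"
    by simp
  have "L1_norm (\<lambda>x. shift (vn n) (an n) x - shift v a x) \<le>
      L1_norm (\<lambda>x. an n x - a x) + L1_norm (\<lambda>x. a (x + (vn n - v)) - a x)" for n
  proof -
    have "L1_norm (\<lambda>x. an n (x + vn n) - a (x + v)) \<le>
        L1_norm (\<lambda>x. an n (x + vn n) - a (x + vn n)) + L1_norm (\<lambda>x. a (x + vn n) - a (x + v))"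
      by (rule L1_norm_diff_triangle) auto
    moreover have "L1_norm (\<lambda>x. an n (x + vn n) - a (x + vn n)) = L1_norm (\<lambda>x. an n x - a x)"
      by (rule L1_norm_translate[where f = "\<lambda>x. an n x - a x"]) auto
    moreover have "L1_norm (\<lambda>x. a (x + vn n) - a (x + v)) = L1_norm (\<lambda>x. a (x + (vn n - v)) - a x)"
      using L1_norm_translate[where f = "\<lambda>x. a (x + (vn n - v)) - a x" and h = v] by simp
    ultimately show ?thesis by (simp add: shift_def)
  qed
  then show "\<forall>\<^sub>F n in sequentially. L1_norm (\<lambda>x. shift (vn n) (an n) x - shift v a x) \<le>
      L1_norm (\<lambda>x. an n x - a x) + L1_norm (\<lambda>x. a (x + (vn n - v)) - a x)"
    by simp
qed simp

text \<open>Continuity of translation made uniform over all shifts with small coordinates, the form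
  in which both discretisation errors appear.\<close>

lemma L1_small_shifts:
  fixes a :: "real ^ 'n \<Rightarrow> real"
  assumes "a \<in> L1" "\<epsilon> \<longlonglongrightarrow> 0" "0 < r"
  shows "\<forall>\<^sub>F n in sequentially. \<forall>h. (\<forall>i. \<bar>h $ i\<bar> < \<epsilon> n) \<longrightarrow> L1_norm (\<lambda>x. a (x + h) - a x) \<le> ennreal r"
proof -
  have "\<forall>\<^sub>F h in nhds 0. L1_norm (\<lambda>x. a (x + h) - a x) < ennreal r"
    using L1_shift_continuous[OF assms(1)] assms(3) unfolding L1_shift_continuous_def
    by (intro order_tendstoD(2)) auto
  then obtain d where d: "0 < d" "\<And>h. norm h < d \<Longrightarrow> L1_norm (\<lambda>x. a (x + h) - a x) < ennreal r"
    by (auto simp: eventually_nhds_metric)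
  have "(\<lambda>n. real CARD('n) * \<epsilon> n) \<longlonglongrightarrow> real CARD('n) * 0"
    by (intro tendsto_mult tendsto_const assms)
  then have "\<forall>\<^sub>F n in sequentially. real CARD('n) * \<epsilon> n < d"
    using d(1) by (intro order_tendstoD(2)) auto
  then show ?thesis
  proof eventually_elim
    case (elim n)
    then show ?case
      using d(2) norm_less_of_components less_imp_le less_trans by metis
  qed
qed

lemma cube_exp_tendsto:
  fixes a :: "real ^ 'n \<Rightarrow> real"
  assumes "a \<in> L1" "\<And>n. \<epsilon> n > 0" "\<epsilon> \<longlonglongrightarrow> 0" and an: "\<And>n. an n \<in> L1"
    and lim: "(\<lambda>n. L1_norm (\<lambda>x. an n x - a x)) \<longlonglongrightarrow> 0"
  shows "(\<lambda>n. L1_norm (\<lambda>x. cube_exp (\<epsilon> n) (an n) x - a x)) \<longlonglongrightarrow> 0"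
proof (rule tendsto_zero_ennreal)
  fix r :: real assume "0 < r"
  \<comment> \<open>The power of 2 compensates the constant of
    \<open>L1_norm_cube_exp_diff_le\<close>. Bounds \<open>r / 2\<close> and \<open>r / 3\<close>
    for the two errors leave room for a strict inequality.\<close>
  define e where "e = r / 3 / 2 ^ CARD('n)"
  have e: "0 < e" "2 ^ CARD('n) * ennreal e = ennreal (r / 3)"
  proof -
    show "0 < e" using \<open>0 < r\<close> by (simp add: e_def)
    have "2 ^ CARD('n) * ennreal e = ennreal (2 ^ CARD('n)) * ennreal e"
      by (simp flip: ennreal_power)
    also have "\<dots> = ennreal (r / 3)"
      using \<open>0 < r\<close> by (simp add: e_def flip: ennreal_mult)
    finally show "2 ^ CARD('n) * ennreal e = ennreal (r / 3)" .
  qed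
  have [measurable]: "a \<in> borel_measurable borel" "an n \<in> borel_measurable borel"
      "cube_exp (\<epsilon> n) a \<in> borel_measurable borel" "cube_exp (\<epsilon> n) (an n) \<in> borel_measurable borel" for n
    using assms by (auto intro: L1_borel_measurable cube_exp_measurable)
  have "\<forall>\<^sub>F n in sequentially. L1_norm (\<lambda>x. an n x - a x) < ennreal (r / 2)"
    using lim \<open>0 < r\<close> by (intro order_tendstoD(2)) auto
  then show "\<forall>\<^sub>F n in sequentially. L1_norm (\<lambda>x. cube_exp (\<epsilon> n) (an n) x - a x) < ennreal r"
    using L1_small_shifts[OF assms(1,3) e(1)]
  proof eventually_elim
    case (elim n)
    have "L1_norm (\<lambda>x. cube_exp (\<epsilon> n) (an n) x - a x) \<le>
        L1_norm (\<lambda>x. cube_exp (\<epsilon> n) (an n) x - cube_exp (\<epsilon> n) a x) +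
        L1_norm (\<lambda>x. cube_exp (\<epsilon> n) a x - a x)"
      by (rule L1_norm_diff_triangle) auto
    also have "L1_norm (\<lambda>x. cube_exp (\<epsilon> n) (an n) x - cube_exp (\<epsilon> n) a x) \<le> L1_norm (\<lambda>x. an n x - a x)"
    proof -
      have "(\<lambda>x. cube_exp (\<epsilon> n) (an n) x - cube_exp (\<epsilon> n) a x) = cube_exp (\<epsilon> n) (\<lambda>x. an n x - a x)"
        by (intro ext cube_exp_diff[symmetric] assms)
      then show ?thesis by (simp add: L1_norm_cube_exp_le assms)
    qed
    also have "L1_norm (\<lambda>x. cube_exp (\<epsilon> n) a x - a x) \<le> 2 ^ CARD('n) * ennreal e"
      using elim assms by (intro L1_norm_cube_exp_diff_le) auto
    finally have "L1_norm (\<lambda>x. cube_exp (\<epsilon> n) (an n) x - a x) \<le>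
        L1_norm (\<lambda>x. an n x - a x) + ennreal (r / 3)"
      by (simp add: e(2) add_right_mono)
    also have "\<dots> < ennreal (r / 2) + ennreal (r / 2)"
      using elim(1) \<open>0 < r\<close> by (intro add_strict_mono ennreal_lessI) auto
    also have "\<dots> = ennreal r" using \<open>0 < r\<close> by (simp flip: ennreal_plus)
    finally show ?case .
  qed
qed

lemma discrete_conv_tendsto:
  fixes a :: "real ^ 'n \<Rightarrow> real"
  assumes \<kappa>: "\<kappa> \<in> kernels" and "a \<in> L1" "\<And>n. \<epsilon> n > 0" "\<epsilon> \<longlonglongrightarrow> 0" and bn: "\<And>n. bn n \<in> L1"
    and lim: "(\<lambda>n. L1_norm (\<lambda>x. bn n x - a x)) \<longlonglongrightarrow> 0"
  shows "(\<lambda>n. L1_norm (\<lambda>x. discrete_conv (\<epsilon> n) \<kappa> (bn n) x - conv \<kappa> a x)) \<longlonglongrightarrow> 0"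
proof (rule tendsto_zero_ennreal)
  fix r :: real assume "0 < r"
  have [measurable]: "a \<in> borel_measurable borel" "bn n \<in> borel_measurable borel" for n
    using assms by (auto intro: L1_borel_measurable)
  have "\<forall>\<^sub>F n in sequentially. L1_norm (\<lambda>x. bn n x - a x) < ennreal (r / 3)"
    using lim \<open>0 < r\<close> by (intro order_tendstoD(2)) auto
  moreover have "\<forall>\<^sub>F n in sequentially. \<forall>h. (\<forall>i. \<bar>h $ i\<bar> < \<epsilon> n) \<longrightarrow>
      L1_norm (\<lambda>x. a (x + h) - a x) \<le> ennreal (r / 3)"
    using \<open>0 < r\<close> assms by (intro L1_small_shifts) auto
  ultimately show "\<forall>\<^sub>F n in sequentially.
      L1_norm (\<lambda>x. discrete_conv (\<epsilon> n) \<kappa> (bn n) x - conv \<kappa> a x) < ennreal r"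
  proof eventually_elim
    case (elim n)
    let ?q = "grid_round (\<epsilon> n) :: real ^ 'n \<Rightarrow> real ^ 'n"
    have eq: "discrete_conv (\<epsilon> n) \<kappa> (bn n) = smear ?q \<kappa> (bn n)"
      using assms by (intro ext discrete_conv_smear) auto
    \<comment> \<open>For each \<open>y\<close>, one third pays for replacing \<open>bn n\<close> by
      \<open>a\<close> and one third for replacing the rounded translation by the exact one; the
      bound is uniform in \<open>y\<close>.\<close>
    have "L1_norm (\<lambda>x. smear ?q \<kappa> (bn n) x - smear (\<lambda>y. y) \<kappa> a x) \<le> ennreal (r / 3 + r / 3)"
    proof (rule L1_norm_smear_diff_le[OF \<kappa>])
      show "integrable lborel (\<lambda>y. \<kappa> y * bn n (x - ?q y))" for x
        using assms by (intro discrete_conv_smear) auto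
      show "integrable lborel (\<lambda>y. \<kappa> y * a (x - y))" for x
        using assms by (intro integrable_kernel_mult)
      fix y
      have "L1_norm (\<lambda>x. bn n (x - ?q y) - a (x - y)) \<le>
          L1_norm (\<lambda>x. bn n (x - ?q y) - a (x - ?q y)) + L1_norm (\<lambda>x. a (x - ?q y) - a (x - y))"
        by (rule L1_norm_diff_triangle) auto
      also have "L1_norm (\<lambda>x. bn n (x - ?q y) - a (x - ?q y)) = L1_norm (\<lambda>x. bn n x - a x)"
        using L1_norm_translate[where f = "\<lambda>x. bn n x - a x" and h = "- ?q y"] by simp
      also have "L1_norm (\<lambda>x. a (x - ?q y) - a (x - y)) = L1_norm (\<lambda>x. a (x + (y - ?q y)) - a x)"
        using L1_norm_translate[where f = "\<lambda>x. a (x + (y - ?q y)) - a x" and h = "- y"] by simp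
      also have "\<dots> \<le> ennreal (r / 3)"
        using elim grid_round_dist[OF assms(3)] by blast
      finally have "L1_norm (\<lambda>x. bn n (x - ?q y) - a (x - y)) \<le>
          L1_norm (\<lambda>x. bn n x - a x) + ennreal (r / 3)"
        by (simp add: add_left_mono)
      also have "\<dots> \<le> ennreal (r / 3) + ennreal (r / 3)"
        using elim(1) by (intro add_mono) auto
      finally show "L1_norm (\<lambda>x. bn n (x - ?q y) - a (x - y)) \<le> ennreal (r / 3 + r / 3)"
        using \<open>0 < r\<close> by (simp only: ennreal_plus)
    qed (use assms in \<open>auto intro: grid_round_measurable\<close>)
    also have "\<dots> < ennreal r" using \<open>0 < r\<close> by (intro ennreal_lessI) auto
    finally show ?case by (simp add: eq conv_eq_smear)
  qed
qed

lemma discrete_RealLife_tendsto: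
  fixes a :: "real ^ 'n \<Rightarrow> real"
  assumes \<theta>: "\<theta> \<in> Theta" and \<kappa>: "\<kappa> \<in> kernels" and a: "a \<in> L1_classes (configs0 \<theta> \<kappa>)"
    and \<epsilon>: "\<And>n. \<epsilon> n > 0" "\<epsilon> \<longlonglongrightarrow> 0" and an: "\<And>n. an n \<in> L1"
    and lim: "(\<lambda>n. L1_norm (\<lambda>x. an n x - a x)) \<longlonglongrightarrow> 0"
  shows "(\<lambda>n. L1_norm (\<lambda>x. discrete_RealLife \<theta> \<kappa> (\<epsilon> n) (an n) x - RealLife \<theta> \<kappa> a x)) \<longlonglongrightarrow> 0"
proof -
  obtain s0 b0 b1 s1 where \<theta>_eq: "\<theta> = (s0, b0, b1, s1)" by (cases \<theta>)
  have ord: "0 < s0" "s0 \<le> s1" "0 < b0" "b0 \<le> b1" using \<theta> by (auto simp: Theta_def \<theta>_eq)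
  obtain a' where a': "a' \<in> configs1" "a \<doteq> a'"
      and null: "{x. conv \<kappa> a' x \<in> {s0, b0, b1, s1}} \<in> null_sets lborel"
    and aL1: "a \<in> L1"
    using a by (auto simp: L1_classes_def \<theta>_eq)
  have a'L1: "a' \<in> L1" using a' by (simp add: configs1_def)
  \<comment> \<open>A member of the class need not be 0-1 valued everywhere. Its convolution
    coincides with that of a genuine configuration, so the endpoint condition carries over.\<close>
  have conv_eq: "conv \<kappa> a = conv \<kappa> a'"
    using \<kappa> aL1 a'L1 a'(2) by (intro conv_cong_AE) (auto simp: kernels_def)
  have ae01: "AE x in lborel. a x \<in> {0, 1}"
    using a'(2) unfolding L1_eq_def
    by eventually_elim (use a'(1) in \<open>auto simp: configs1_def configs_def\<close>)
  have generic: "AE x in lborel. conv \<kappa> a x \<notin> {s0, b0, b1, s1}"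
    using AE_not_in[OF null] by (simp add: conv_eq)
  define bn where "bn n = cube_exp (\<epsilon> n) (an n)" for n
  define vn where "vn n = discrete_conv (\<epsilon> n) \<kappa> (bn n)" for n
  have bn: "bn n \<in> L1" for n unfolding bn_def by (intro cube_exp_L1 \<epsilon> an)
  have vn: "vn n \<in> L1" for n unfolding vn_def by (intro discrete_conv_L1 \<kappa> \<epsilon> bn)
  have u: "conv \<kappa> a \<in> L1" by (intro conv_L1 \<kappa> aL1)
  have bn_lim: "(\<lambda>n. L1_norm (\<lambda>x. bn n x - a x)) \<longlonglongrightarrow> 0"
    unfolding bn_def by (intro cube_exp_tendsto aL1 \<epsilon> an lim)
  have vn_lim: "(\<lambda>n. L1_norm (\<lambda>x. vn n x - conv \<kappa> a x)) \<longlonglongrightarrow> 0"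
    unfolding vn_def by (intro discrete_conv_tendsto \<kappa> aL1 \<epsilon> bn bn_lim)
  have "(\<lambda>n. L1_norm (\<lambda>x. bn n x - a x) +
    (L1_norm (\<lambda>x. indicator {s0..s1} (vn n x) - indicator {s0..s1} (conv \<kappa> a x)) +
     L1_norm (\<lambda>x. indicator {b0..b1} (vn n x) - indicator {b0..b1} (conv \<kappa> a x)))) \<longlonglongrightarrow> 0 + (0 + 0)"
  proof (intro tendsto_add bn_lim L1_norm_indicator_Icc_tendsto ord u vn_lim
      L1_borel_measurable vn)
  qed (use generic in \<open>auto elim: eventually_mono\<close>)
  then have upper: "(\<lambda>n. L1_norm (\<lambda>x. bn n x - a x) +
    (L1_norm (\<lambda>x. indicator {s0..s1} (vn n x) - indicator {s0..s1} (conv \<kappa> a x)) +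
     L1_norm (\<lambda>x. indicator {b0..b1} (vn n x) - indicator {b0..b1} (conv \<kappa> a x)))) \<longlonglongrightarrow> 0" by simp
  have le: "L1_norm (\<lambda>x. discrete_RealLife \<theta> \<kappa> (\<epsilon> n) (an n) x - RealLife \<theta> \<kappa> a x) \<le>
    L1_norm (\<lambda>x. bn n x - a x) +
    (L1_norm (\<lambda>x. indicator {s0..s1} (vn n x) - indicator {s0..s1} (conv \<kappa> a x)) +
     L1_norm (\<lambda>x. indicator {b0..b1} (vn n x) - indicator {b0..b1} (conv \<kappa> a x)))" for n
    unfolding discrete_RealLife_def Let_def RealLife_def bn_def[symmetric] vn_def[symmetric] \<theta>_eq
    by (intro L1_norm_life_rule_diff_le ae01 L1_borel_measurable aL1 bn vn u)
  show ?thesis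
    by (rule tendsto_sandwich[OF _ _ tendsto_const upper]) (use le in auto)
qed

section \<open>Shift invariance and the evolution property\<close>

lemma shift_invariant_classes_configs0:
  fixes \<kappa> :: "real ^ 'n \<Rightarrow> real"
  assumes \<kappa>: "\<kappa> \<in> kernels"
  shows "shift_invariant (L1_classes (configs0 \<theta> \<kappa>))"
  unfolding shift_invariant_def
proof (intro allI ballI)
  fix v and a :: "real ^ 'n \<Rightarrow> real" assume "a \<in> L1_classes (configs0 \<theta> \<kappa>)"
  then obtain a' where a: "a \<in> L1" "a' \<in> configs0 \<theta> \<kappa>" "a \<doteq> a'" by (auto simp: L1_classes_def)
  obtain s0 b0 b1 s1 where \<theta>_eq: "\<theta> = (s0, b0, b1, s1)" by (cases \<theta>)
  have shift_L1: "shift v f \<in> L1" if "f \<in> L1" for f :: "real ^ 'n \<Rightarrow> real"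
    using that L1_norm_translate[of f v]
    by (auto simp: L1_iff_norm_finite shift_def)
  have a': "a' \<in> configs" "a' \<in> L1"
      and null: "{x. conv \<kappa> a' x \<in> {s0, b0, b1, s1}} \<in> null_sets lborel"
    using a by (auto simp: \<theta>_eq configs1_def)
  have [measurable]: "a \<in> borel_measurable borel" "a' \<in> borel_measurable borel"
      "conv \<kappa> a' \<in> borel_measurable borel"
    using a a' conv_L1[OF \<kappa>] by (auto intro: L1_borel_measurable)
  have conf: "shift v a' \<in> configs1"
    using a' shift_L1 by (auto simp: configs1_def configs_def shift_def)
  define N where "N = {x. conv \<kappa> a' x \<in> {s0, b0, b1, s1}}"
  have [measurable]: "N \<in> sets borel" using null by (auto simp: N_def)
  have "{x. x + v \<in> N} = (\<lambda>x. x + v) -` N \<inter> space borel" by auto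
  also have "\<dots> \<in> sets borel" by (rule measurable_sets[of _ _ borel]) measurable
  finally have meas: "{x. x + v \<in> N} \<in> sets borel" .
  have "emeasure lborel {x. x + v \<in> N} = (\<integral>\<^sup>+x. indicator {x. x + v \<in> N} x \<partial>lborel)"
    using meas by simp
  also have "\<dots> = (\<integral>\<^sup>+x. indicator N (x + v) \<partial>lborel)"
    by (simp add: indicator_def)
  also have "\<dots> = (\<integral>\<^sup>+x. indicator N x \<partial>lborel)"
    by (rule nn_integral_lborel_translate) measurable
  also have "\<dots> = 0" using null by (simp add: N_def null_sets_def)
  finally have "{x. x + v \<in> N} \<in> null_sets lborel"
    using meas by (simp add: null_sets_def)
  \<comment> \<open>Convolution commutes with shifts, so the exceptional set of the shifted
    configuration is a translate of the original one.\<close>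
  then have "{x. conv \<kappa> (shift v a') x \<in> {s0, b0, b1, s1}} \<in> null_sets lborel"
    unfolding conv_shift by (simp add: shift_def N_def)
  then have "shift v a' \<in> configs0 \<theta> \<kappa>" using conf by (simp add: \<theta>_eq)
  moreover have "shift v a \<doteq> shift v a'"
    using L1_eq_translate[of a a' v] a(3) by (simp add: shift_def[abs_def])
  ultimately show "shift v a \<in> L1_classes (configs0 \<theta> \<kappa>)"
    using shift_L1[OF a(1)] by (auto simp: L1_classes_def simp del: configs0.simps)
qed

lemma L1_subset_classes: "L1_subset (L1_classes A)"
  unfolding L1_subset_def L1_classes_def L1_eq_def
proof (intro conjI ballI impI CollectI)
  fix f g assume "f \<in> {f \<in> L1. \<exists>a\<in>A. AE x in lborel. f x = a x}" and fg: "AE x in lborel. f x = g x"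
  then obtain a where a: "a \<in> A" "AE x in lborel. f x = a x" by blast
  have "AE x in lborel. g x = a x" using fg a(2) by eventually_elim simp
  then show "\<exists>a\<in>A. AE x in lborel. g x = a x" using a(1) by blast
qed auto

lemma L1_map_funpow_L1: "L1_map \<Phi> \<Longrightarrow> f \<in> L1 \<Longrightarrow> (\<Phi> ^^ p) f \<in> L1"
  by (induction p) (auto simp: L1_map_def)

text \<open>Convergence of a single step on \<open>A\<close> implies every clause. The
  travelling-wave equation identifies two sequences with separate limits, the iterated map and the
  shift; uniqueness of limits then gives the equation for \<open>\<Phi>\<close>.\<close>

lemma evolves_toI:
  fixes \<Phi> :: "(real ^ 'n \<Rightarrow> real) \<Rightarrow> real ^ 'n \<Rightarrow> real"
  assumes \<Phi>n: "\<And>n. L1_map (\<Phi>n n)" and \<Phi>: "L1_map \<Phi>"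
    and A: "L1_subset A" "shift_invariant A"
    and step: "\<And>an a. (\<And>n. an n \<in> L1) \<Longrightarrow> a \<in> A \<Longrightarrow> (\<lambda>n. L1_norm (\<lambda>x. an n x - a x)) \<longlonglongrightarrow> 0 \<Longrightarrow>
      (\<lambda>n. L1_norm (\<lambda>x. \<Phi>n n (an n) x - \<Phi> a x)) \<longlonglongrightarrow> 0"
  shows "evolves_to \<Phi>n \<Phi> A"
proof -
  have travel: "(\<Phi> ^^ P) a \<doteq> shift (real P *\<^sub>R v) a"
    if an: "\<And>n. an n \<in> L1" and a: "a \<in> A" and lim: "(\<lambda>n. L1_norm (\<lambda>x. an n x - a x)) \<longlonglongrightarrow> 0"
      and orbit: "\<And>p. p < P \<Longrightarrow> (\<Phi> ^^ p) a \<in> A" and v: "vn \<longlonglongrightarrow> v"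
      and eq: "\<And>n. (\<Phi>n n ^^ P) (an n) \<doteq> shift (real P *\<^sub>R vn n) (an n)" for an a P vn v
  proof -
    have aL1: "a \<in> L1" using a A by (auto simp: L1_subset_def)
    \<comment> \<open>Passing from \<open>p\<close> to \<open>Suc p\<close> uses membership in
      \<open>A\<close> only at time \<open>p\<close>. The orbit hypothesis below \<open>P\<close>
      thus reaches time \<open>P\<close>, although the last iterate may leave
      \<open>A\<close>.\<close>
    have iter: "(\<lambda>n. L1_norm (\<lambda>x. (\<Phi>n n ^^ p) (an n) x - (\<Phi> ^^ p) a x)) \<longlonglongrightarrow> 0" if "p \<le> P" for p
      using that
    proof (induction p)
      case 0
      then show ?case using lim by simp
    next
      case (Suc p)
      then have "(\<lambda>n. L1_norm (\<lambda>x. \<Phi>n n ((\<Phi>n n ^^ p) (an n)) x - \<Phi> ((\<Phi> ^^ p) a) x)) \<longlonglongrightarrow> 0"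
        by (intro step L1_map_funpow_L1 \<Phi>n an orbit) auto
      then show ?case by simp
    qed
    have meas: "(\<Phi>n n ^^ P) (an n) \<in> borel_measurable borel" "(\<Phi> ^^ P) a \<in> borel_measurable borel" for n
      using L1_map_funpow_L1[OF \<Phi>n an] L1_map_funpow_L1[OF \<Phi> aL1] by (auto intro: L1_borel_measurable)
    have [measurable]: "a \<in> borel_measurable borel" by (rule L1_borel_measurable[OF aL1])
    show ?thesis
    proof (rule L1_limit_unique[OF meas(1,2) _ iter[OF order_refl]])
      show "shift (real P *\<^sub>R v) a \<in> borel_measurable borel" unfolding shift_def by measurable
      have "L1_norm (\<lambda>x. (\<Phi>n n ^^ P) (an n) x - shift (real P *\<^sub>R v) a x) =
          L1_norm (\<lambda>x. shift (real P *\<^sub>R vn n) (an n) x - shift (real P *\<^sub>R v) a x)" for n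
        using eq[of n] unfolding L1_eq_def by (intro L1_norm_cong_AE) (auto simp: L1_eq_def)
      moreover have "(\<lambda>n. L1_norm (\<lambda>x. shift (real P *\<^sub>R vn n) (an n) x - shift (real P *\<^sub>R v) a x)) \<longlonglongrightarrow> 0"
        by (intro shift_tendsto aL1 an lim tendsto_scaleR tendsto_const v)
      ultimately show "(\<lambda>n. L1_norm (\<lambda>x. (\<Phi>n n ^^ P) (an n) x - shift (real P *\<^sub>R v) a x)) \<longlonglongrightarrow> 0"
        by simp
    qed
  qed
  \<comment> \<open>Periodic points are travelling waves of velocity 0, and fixed points are the
    case \<open>P = 1\<close>.\<close>
  have periodic: "(\<Phi> ^^ P) a \<doteq> a"
    if "\<And>n. an n \<in> L1" "a \<in> A" "(\<lambda>n. L1_norm (\<lambda>x. an n x - a x)) \<longlonglongrightarrow> 0"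
      "\<And>p. p < P \<Longrightarrow> (\<Phi> ^^ p) a \<in> A" "\<And>n. (\<Phi>n n ^^ P) (an n) \<doteq> an n" for an a P
    using travel[where vn = "\<lambda>_. 0" and v = 0, OF that(1-4)] that(5) by (simp add: shift_def)
  show ?thesis
    unfolding evolves_to_def
  proof (intro conjI allI impI \<Phi>n \<Phi> A)
    fix an a
    assume *: "\<forall>n. an n \<in> L1" "a \<in> A" "(\<lambda>n. L1_norm (\<lambda>x. an n x - a x)) \<longlonglongrightarrow> 0"
    show "\<Phi> a \<doteq> a" if "\<forall>n. \<Phi>n n (an n) \<doteq> an n"
      using periodic[of an a 1] * that by simp
    fix P :: nat assume "\<forall>p<P. (\<Phi> ^^ p) a \<in> A"
    then show "(\<Phi> ^^ P) a \<doteq> a" if "\<forall>n. (\<Phi>n n ^^ P) (an n) \<doteq> an n"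
      using periodic[of an a P] * that by blast
    fix vn :: "nat \<Rightarrow> real ^ 'n" and v
    assume "vn \<longlonglongrightarrow> v" "\<forall>n. (\<Phi>n n ^^ P) (an n) \<doteq> shift (real P *\<^sub>R vn n) (an n)"
    with \<open>\<forall>p<P. (\<Phi> ^^ p) a \<in> A\<close> show "(\<Phi> ^^ P) a \<doteq> shift (real P *\<^sub>R v) a"
      using travel[of an a P vn v] * by blast
  qed
qed

theorem theorem2p1:
  fixes \<theta> :: "real \<times> real \<times> real \<times> real"
    and \<kappa> :: "real ^ 'n \<Rightarrow> real"
  assumes "\<theta> \<in> Theta" and "\<kappa> \<in> kernels"
  shows "(\<forall>a \<in> configs0 \<theta> \<kappa>.
            ((\<lambda>\<epsilon>. L1_norm (\<lambda>x. discrete_RealLife \<theta> \<kappa> \<epsilon> a x - RealLife \<theta> \<kappa> a x)) \<longlongrightarrow> 0)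
              (at_right 0))
       \<and> (\<forall>\<epsilon> :: nat \<Rightarrow> real. (\<forall>n. \<epsilon> n > 0) \<longrightarrow> \<epsilon> \<longlonglongrightarrow> 0 \<longrightarrow>
            evolves_to (\<lambda>n. discrete_RealLife \<theta> \<kappa> (\<epsilon> n)) (RealLife \<theta> \<kappa>)
              (L1_classes (configs0 \<theta> \<kappa>)))"
proof (intro conjI ballI allI impI)
  fix a assume a: "a \<in> configs0 \<theta> \<kappa>"
  then have aL1: "a \<in> L1" by (cases \<theta>) (auto simp: configs1_def)
  then have "a \<in> L1_classes (configs0 \<theta> \<kappa>)"
    using a by (auto simp: L1_classes_def L1_eq_def)
  show "((\<lambda>\<epsilon>. L1_norm (\<lambda>x. discrete_RealLife \<theta> \<kappa> \<epsilon> a x - RealLife \<theta> \<kappa> a x)) \<longlongrightarrow> 0) (at_right 0)"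
    \<comment> \<open>The one-sided limit is tested along sequences, with the constant sequence
      \<open>a\<close> as initial data.\<close>
    unfolding tendsto_at_iff_sequentially comp_def
  proof (intro allI impI)
    fix X :: "nat \<Rightarrow> real" assume "\<forall>i. X i \<in> {0<..} - {0}" "X \<longlonglongrightarrow> 0"
    then show "(\<lambda>n. L1_norm (\<lambda>x. discrete_RealLife \<theta> \<kappa> (X n) a x - RealLife \<theta> \<kappa> a x)) \<longlonglongrightarrow> 0"
      using assms aL1 \<open>a \<in> L1_classes _\<close>
      by (intro discrete_RealLife_tendsto) (auto simp: L1_norm_def)
  qed
next
  fix \<epsilon> :: "nat \<Rightarrow> real" assume "\<forall>n. \<epsilon> n > 0" "\<epsilon> \<longlonglongrightarrow> 0"
  then show "evolves_to (\<lambda>n. discrete_RealLife \<theta> \<kappa> (\<epsilon> n)) (RealLife \<theta> \<kappa>) (L1_classes (configs0 \<theta> \<kappa>))"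
    using assms
    by (intro evolves_toI L1_map_discrete_RealLife L1_map_RealLife L1_subset_classes
        shift_invariant_classes_configs0 discrete_RealLife_tendsto) auto
qed

end
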